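(* Let $m\ge2$, $\delta>-m$, and let $(G_n)_{n\ge2}$ be a sequence of preferential attachment graphs of model (a), (b) or (d) with parameters $m$ and $\delta$, started from a multigraph on $\{1,2\}$ in which vertex $2$ has degree $a_2\le m$. Then there is a constant $d<\infty$ such that for every $\epsilon>0$ there exists $\alpha>0$ such that, with probability tending to $1$ as $n\to\infty$, $G_n$ is an $(\alpha,\epsilon,d)$-large-set expander. In particular, there exists a constant $c>0$ such that $$\mathbb P\big(\alpha(G_n,\epsilon)<\alpha\big)=o(e^{-cn}).$$
   Context: **Large-set expanders.** For a finite undirected multigraph $G$ and $\epsilon>0$, let $$\alpha(G,\epsilon)=\min_{S\subset V(G):\ \epsilon|V(G)|\le|S|\le|V(G)|/2}\frac{|\mathrm{cut}_G(S,S^c)|}{|S|},$$ where $\mathrm{cut}_G(S,S^c)$ is the set of edges (with multiplicity) with one end in $S$ and the other in $S^c$. $G$ is an $(\alpha,\epsilon,d)$-large-set expander if its average degree is at most $d$ and $\alpha(G,\epsilon)\ge\alpha$. **Models.** Start from a finite multigraph on $\{1,2\}$ (self-loops allowed) with degrees $a_1,a_2$, and let $a_{[2]}=a_1+a_2$. A self-loop contributes $2$ to the degree. (It is assumed that $a_i+\delta>0$.) Vertices $v=3,4,\dots$ arrive successively, each with $m$ edges, attached one at a time; $d_u(v,j-1)$ is the degree of $u$ after the first $j-1$ edges of $v$ have been attached. Given the current graph, the $j$-th edge of $v$ attaches to $u$ with probability: - Model (a): $\frac{d_u(v,j-1)+\delta}{c_{v,j}}$ for $u<v$ and $\frac{d_v(v,j-1)+1+j\delta/m}{c_{v,j}}$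 for $u=v$, with $c_{v,j}=a_{[2]}+2\delta+(2m+\delta)(v-3)+2(j-1)+1+\frac{j\delta}m$. - Model (b): $\frac{d_u(v,j-1)+\delta}{c_{v,j}}$ for $u<v$ and $\frac{d_v(v,j-1)+(j-1)\delta/m}{c_{v,j}}$ for $u=v$, with $c_{v,j}=a_{[2]}+2\delta+(2m+\delta)(v-3)+2(j-1)+\frac{(j-1)\delta}m$. - Model (d): $\frac{d_u(v,j-1)+\delta}{c_{v,j}}$ for $u<v$ (no self-loops), with $c_{v,j}=a_{[2]}+2\delta+(2m+\delta)(v-3)+(j-1)$. $G_n$ is the graph once all edges of vertex $n$ have been attached. *)

theory Defs
  imports "HOL-Probability.Probability" "HOL-Library.Landau_Symbols" "HOL-Library.Multiset"
begin

section \<open>Multigraphs and large-set expanders\<close>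

text \<open>
  An undirected edge is the two-element multiset of its end points, so a self-loop at \<open>v\<close> is
  \<open>{#v, v#}\<close> and contributes \<open>2\<close> to the degree of \<open>v\<close>.
\<close>

datatype 'v mgraph = MGraph (verts: "'v set") (edges: "'v multiset multiset")

definition multigraph :: "'v mgraph \<Rightarrow> bool" where
  "multigraph G \<longleftrightarrow>
     finite (verts G) \<and> (\<forall>e \<in># edges G. size e = 2 \<and> set_mset e \<subseteq> verts G)"

definition mdegree :: "'v mgraph \<Rightarrow> 'v \<Rightarrow> nat" where
  "mdegree G v = (\<Sum>e \<in># edges G. count e v)"

definition avg_degree :: "'v mgraph \<Rightarrow> real" where
  "avg_degree G = (\<Sum>v \<in> verts G. real (mdegree G v)) / real (card (verts G))"

definition cut :: "'v mgraph \<Rightarrow> 'v set \<Rightarrow> 'v set \<Rightarrow> 'v multiset multiset" where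
  "cut G S T = filter_mset (\<lambda>e. \<exists>x \<in> S. \<exists>y \<in> T. e = {#x, y#}) (edges G)"

text \<open>
  The minimum is over a finite set of candidates. It is taken in the extended reals, so that it is
  \<open>\<infinity>\<close> when there is no candidate (e.g. if \<open>\<epsilon> > 1/2\<close>).
\<close>

definition expansion :: "'v mgraph \<Rightarrow> real \<Rightarrow> ereal" where
  "expansion G \<epsilon> =
     (INF S \<in> {S. S \<subseteq> verts G \<and> \<epsilon> * real (card (verts G)) \<le> real (card S)
                  \<and> real (card S) \<le> real (card (verts G)) / 2}.
        ereal (real (size (cut G S (verts G - S))) / real (card S)))"

definition large_set_expander :: "real \<Rightarrow> real \<Rightarrow> real \<Rightarrow> 'v mgraph \<Rightarrow> bool" where
  "large_set_expander \<alpha> \<epsilon> d G \<longleftrightarrow> avg_degree G \<le> d \<and> ereal \<alpha> \<le> expansion G \<epsilon>"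


section \<open>Preferential attachment\<close>

datatype pa_model = Model_a | Model_b | Model_d

text \<open>The normalising constant \<open>c\<^sub>v\<^sub>,\<^sub>j\<close>; here \<open>a\<close> is the total degree of the initial graph.\<close>

fun pa_norm :: "pa_model \<Rightarrow> nat \<Rightarrow> real \<Rightarrow> nat \<Rightarrow> nat \<Rightarrow> nat \<Rightarrow> real" where
  "pa_norm Model_a m \<delta> a v j =
     real a + 2 * \<delta> + (2 * real m + \<delta>) * (real v - 3) + 2 * (real j - 1) + 1 + real j * \<delta> / real m"
| "pa_norm Model_b m \<delta> a v j =
     real a + 2 * \<delta> + (2 * real m + \<delta>) * (real v - 3) + 2 * (real j - 1) + (real j - 1) * \<delta> / real m"
| "pa_norm Model_d m \<delta> a v j =
     real a + 2 * \<delta> + (2 * real m + \<delta>) * (real v - 3) + (real j - 1)"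

fun pa_self_weight :: "pa_model \<Rightarrow> nat \<Rightarrow> real \<Rightarrow> nat mgraph \<Rightarrow> nat \<Rightarrow> nat \<Rightarrow> real" where
  "pa_self_weight Model_a m \<delta> G v j = real (mdegree G v) + 1 + real j * \<delta> / real m"
| "pa_self_weight Model_b m \<delta> G v j = real (mdegree G v) + (real j - 1) * \<delta> / real m"
| "pa_self_weight Model_d m \<delta> G v j = 0"

text \<open>
  The probability that the \<open>j\<close>-th edge of \<open>v\<close> attaches to \<open>u\<close>, where \<open>G\<close> is the current graph,
  in which \<open>v\<close> is present with its first \<open>j - 1\<close> edges.
\<close>

definition attach_prob ::
    "pa_model \<Rightarrow> nat \<Rightarrow> real \<Rightarrow> nat \<Rightarrow> nat \<Rightarrow> nat \<Rightarrow> nat mgraph \<Rightarrow> nat \<Rightarrow> real" where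
  "attach_prob M m \<delta> a v j G u =
     (if 1 \<le> u \<and> u < v then (real (mdegree G u) + \<delta>) / pa_norm M m \<delta> a v j
      else if u = v then pa_self_weight M m \<delta> G v j / pa_norm M m \<delta> a v j
      else 0)"

definition add_vertex :: "'v \<Rightarrow> 'v mgraph \<Rightarrow> 'v mgraph" where
  "add_vertex v G = MGraph (insert v (verts G)) (edges G)"

definition add_edge :: "'v \<Rightarrow> 'v \<Rightarrow> 'v mgraph \<Rightarrow> 'v mgraph" where
  "add_edge u v G = MGraph (verts G) (add_mset {#u, v#} (edges G))"

definition attach_edge ::
    "pa_model \<Rightarrow> nat \<Rightarrow> real \<Rightarrow> nat \<Rightarrow> nat \<Rightarrow> nat \<Rightarrow> nat mgraph \<Rightarrow> nat mgraph pmf" where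
  "attach_edge M m \<delta> a v j G =
     map_pmf (\<lambda>u. add_edge u v G) (embed_pmf (attach_prob M m \<delta> a v j G))"

fun attach_edges ::
    "pa_model \<Rightarrow> nat \<Rightarrow> real \<Rightarrow> nat \<Rightarrow> nat \<Rightarrow> nat \<Rightarrow> nat mgraph \<Rightarrow> nat mgraph pmf" where
  "attach_edges M m \<delta> a v 0 G = return_pmf (add_vertex v G)"
| "attach_edges M m \<delta> a v (Suc j) G =
     bind_pmf (attach_edges M m \<delta> a v j G) (attach_edge M m \<delta> a v (Suc j))"

text \<open>
  \<open>embed_pmf\<close> is meaningful only for a probability mass function. The lemma below gives this for
  every current graph whose degrees are as they are in the course of the construction.
\<close>

lemma pmf_attach_prob:
  fixes m :: nat and \<delta> :: real
  assumes m: "m > 0" "\<delta> > - real m" and v: "v \<ge> 3" and j: "1 \<le> j" "j \<le> m"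
    and old: "\<And>u. 1 \<le> u \<Longrightarrow> u < v \<Longrightarrow> real (mdegree G u) + \<delta> > 0"
    and new: "mdegree G v \<ge> j - 1" "M = Model_d \<Longrightarrow> mdegree G v = j - 1"
    and total: "(\<Sum>u = 1..v. mdegree G u) = a + 2 * m * (v - 3) + 2 * (j - 1)"
  shows "pmf (embed_pmf (attach_prob M m \<delta> a v j G)) u = attach_prob M m \<delta> a v j G u"
proof -
  let ?c = "pa_norm M m \<delta> a v j"
  have set: "{1..v} = insert v {1..<v}" using v by auto
  have tot: "(\<Sum>u = 1..<v. real (mdegree G u)) + real (mdegree G v)
      = real a + 2 * real m * (real v - 3) + 2 * (real j - 1)"
  proof -
    have "real (v - 3) = real v - 3" "real (j - 1) = real j - 1"
      using v j by (simp_all add: of_nat_diff)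
    moreover have "(\<Sum>u = 1..<v. real (mdegree G u)) + real (mdegree G v)
        = real a + 2 * real m * real (v - 3) + 2 * real (j - 1)"
      using arg_cong[OF total, of real] unfolding set of_nat_add of_nat_mult of_nat_sum by simp
    ultimately show ?thesis by simp
  qed
  have w: "(\<Sum>u = 1..<v. real (mdegree G u) + \<delta>) + pa_self_weight M m \<delta> G v j = ?c"
    using tot v new(2) j
    by (cases M) (auto simp: sum.distrib of_nat_diff algebra_simps)
  have pos: "(\<Sum>u = 1..<v. real (mdegree G u) + \<delta>) > 0"
    using v by (intro sum_pos) (auto intro!: old)
  have dv: "real (mdegree G v) \<ge> real j - 1" using new(1) j by linarith
  have q: "\<delta> / real m \<ge> - 1" using m by (simp add: field_simps)
  have "real j * (\<delta> / real m) \<ge> real j * (-1)" "(real j - 1) * (\<delta> / real m) \<ge> (real j - 1) * (-1)"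
    using q j by (intro mult_left_mono; simp)+
  then have self: "pa_self_weight M m \<delta> G v j \<ge> 0"
    using dv by (cases M) auto
  have c: "?c > 0" using w pos self by linarith
  have nn: "attach_prob M m \<delta> a v j G u \<ge> 0" for u
    using c self old[of u] by (auto simp: attach_prob_def)
  have "(\<Sum>u \<in> {1..v}. attach_prob M m \<delta> a v j G u)
      = ((\<Sum>u = 1..<v. real (mdegree G u) + \<delta>) + pa_self_weight M m \<delta> G v j) / ?c"
    unfolding set by (simp add: attach_prob_def add_divide_distrib sum_divide_distrib)
  then have s1: "(\<Sum>u \<in> {1..v}. attach_prob M m \<delta> a v j G u) = 1" using w c by simp
  have "(\<integral>\<^sup>+u. ennreal (attach_prob M m \<delta> a v j G u) \<partial>count_space UNIV)
      = (\<Sum>u \<in> {1..v}. ennreal (attach_prob M m \<delta> a v j G u))"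
    using v by (intro nn_integral_count_space') (auto simp: attach_prob_def)
  also have "\<dots> = 1" using s1 nn by (simp add: sum_ennreal)
  finally show ?thesis using nn by (intro pmf_embed_pmf) auto
qed

text \<open>
  A sequence of random graphs on a probability space \<open>\<Omega>\<close>, the initial graph being \<open>G\<^sub>0\<close> on
  \<open>{1, 2}\<close>: given \<open>G\<^sub>2, \<dots>, G\<^sub>n\<close>, the graph \<open>G\<^sub>n\<^sub>+\<^sub>1\<close> arises from \<open>G\<^sub>n\<close> by attaching
  the \<open>m\<close> edges of vertex \<open>n + 1\<close>. Nothing is required of \<open>G 0\<close> and \<open>G 1\<close>.
\<close>

definition pa_sequence ::
    "pa_model \<Rightarrow> nat \<Rightarrow> real \<Rightarrow> nat mgraph \<Rightarrow> 'w measure \<Rightarrow> (nat \<Rightarrow> 'w \<Rightarrow> nat mgraph) \<Rightarrow> bool" where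
  "pa_sequence M m \<delta> G\<^sub>0 \<Omega> G \<longleftrightarrow>
     prob_space \<Omega> \<and>
     (\<forall>n \<ge> 2. G n \<in> measurable \<Omega> (count_space UNIV)) \<and>
     (AE \<omega> in \<Omega>. G 2 \<omega> = G\<^sub>0) \<and>
     (\<forall>n \<ge> 2. \<forall>h g.
        \<P>(\<omega> in \<Omega>. (\<forall>k \<in> {2..n}. G k \<omega> = h k) \<and> G (Suc n) \<omega> = g) =
        \<P>(\<omega> in \<Omega>. \<forall>k \<in> {2..n}. G k \<omega> = h k) *
          pmf (attach_edges M m \<delta> (mdegree G\<^sub>0 1 + mdegree G\<^sub>0 2) (Suc n) m (h n)) g)"

end

(*
  Fix a vertex set S. Which edges cross its boundary determines the total degree of S at every
  time: a non-crossing edge adds 2 to the side of the arriving vertex, a crossing edge adds 1 to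
  each side. So as long as there are at most A crossing edges, an edge of vertex v stays on the
  side of v with probability at most (N + D/2) / (v - 3), where N counts the vertices in {3..<v}
  on that side and D is of order A. Weighting each crossing edge by x = D / (2n) gives
    E [x ^ cut; cut <= A] <= (product of (N + D) / (v - 3)) ^ m,
  which is (n - 2 choose |S|) ^ (- m) up to a factor exp (o(1) n) as D / n tends to 0. Since
  m >= 2, this beats the number of sets S with a factor (n - 2 choose |S|) to spare, and the latter
  is exponentially large when eps n - 2 <= |S| <= n / 2.
*)
theory Submission
  imports Defs "HOL-Real_Asymp.Real_Asymp"
begin

text \<open>The edges are far from independent, and the bound on the probability of staying on one
  side holds only while the cut is small. A cut never shrinks, so setting the weight to zero once
  the cut exceeds \<open>A\<close> keeps the one-step inequality valid at every step, without any
  conditioning. The product over the arriving vertices depends on \<open>S\<close> only through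
  \<open>card S\<close>: in whatever order the two sides receive vertices, each side contributes
  \<open>D\<close>, \<open>D + 1\<close>, \<open>D + 2\<close> and so on. This is what makes it an
  inverse binomial coefficient. A cut of linear size forces \<open>D\<close> to be linear in
  \<open>n\<close>, so \<open>D\<close> is about \<open>n / L\<close>. The two losses, the Markov
  factor \<open>(1 / x) ^ A\<close> and the passage from rising factorials to factorials, are then
  exponential in \<open>n\<close> with rates of order \<open>ln L / L\<close>, and a large fixed
  \<open>L\<close> makes them smaller than the gain. The vertices 1 and 2 are left out of every
  count \<open>N\<close>: their weight goes into \<open>D\<close>, and their position costs a factor
  4 in the union bound.\<close>

section \<open>Binomial estimates\<close>

text \<open>The rising factorial is exactly \<open>fact k\<close> times
  \<open>(k + D - 1) choose k\<close>. In the induction the right-hand side gains the factor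
  \<open>k + D + 1\<close>, the left-hand side only \<open>k + D\<close>.\<close>

lemma pochhammer_le_fact_binomial:
  assumes "D > 0"
  shows "pochhammer (real D) k \<le> fact k * real ((k + D) choose D)"
proof (induction k)
  case (Suc k)
  have "Suc k * (Suc (k + D) choose Suc k) = Suc (k + D) * ((k + D) choose k)"
    by (rule Suc_times_binomial)
  moreover have "(Suc (k + D) choose Suc k) = (Suc k + D choose D)"
    using binomial_symmetric[of "Suc k" "Suc (k + D)"] by simp
  moreover have "((k + D) choose k) = ((k + D) choose D)"
    using binomial_symmetric[of k "k + D"] by simp
  ultimately have "Suc k * (Suc k + D choose D) = Suc (k + D) * ((k + D) choose D)" by simp
  then have eq: "real (Suc k) * real (Suc k + D choose D) = real (Suc (k + D)) * real ((k + D) choose D)"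
    by (metis of_nat_mult)
  have "pochhammer (real D) (Suc k) \<le> real (Suc (k + D)) * (fact k * real ((k + D) choose D))"
    unfolding pochhammer_rec' using Suc assms by (intro mult_mono) (auto intro: pochhammer_nonneg)
  also have "\<dots> = fact k * (real (Suc (k + D)) * real ((k + D) choose D))" by simp
  also have "\<dots> = fact (Suc k) * real (Suc k + D choose D)" unfolding eq[symmetric] by simp
  finally show ?case .
qed simp

lemma binomial_times_power_le:
  fixes y :: real
  assumes "y \<ge> 0"
  shows "real (n choose k) * y ^ k \<le> (1 + y) ^ n"
proof (cases "k \<le> n")
  case True
  have "real (n choose k) * y ^ k \<le> (\<Sum>i\<le>n. real (n choose i) * y ^ i)"
    using True assms by (intro member_le_sum) auto
  also have "\<dots> = (1 + y) ^ n" using binomial_ring[of y 1 n] by (simp add: add.commute)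
  finally show ?thesis .
qed (use assms in \<open>simp add: binomial_eq_0\<close>)

text \<open>A single term of the expansion of \<open>(1 + 1 / L) ^ (n + D)\<close> bounds the
  coefficient divided by \<open>L ^ D\<close>. The resulting rate \<open>(2 + ln L) / L\<close> can
  be made as small as desired.\<close>

lemma binomial_add_le_exp:
  assumes "L \<ge> 1" "real D \<le> real n / L"
  shows "real ((n + D) choose D) \<le> exp (real n * ((2 + ln L) / L))"
proof -
  have "real n / L \<le> real n" using assms by (simp add: divide_le_eq mult_le_cancel_left1)
  then have Dn: "D \<le> n" using assms by linarith
  have "real ((n + D) choose D) * (1 / L) ^ D \<le> (1 + 1 / L) ^ (n + D)"
    using assms by (intro binomial_times_power_le) auto
  also have "\<dots> \<le> exp (1 / L) ^ (n + D)"
    using assms exp_ge_add_one_self[of "1 / L"] by (intro power_mono) auto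
  also have "\<dots> = exp (real (n + D) / L)" by (simp flip: exp_of_nat_mult)
  also have "\<dots> \<le> exp (2 * real n / L)"
    using Dn assms by (simp add: divide_right_mono)
  finally have "real ((n + D) choose D) \<le> exp (2 * real n / L) * L ^ D"
    using assms by (simp add: power_one_over field_simps)
  also have "L ^ D = exp (real D * ln L)" using assms by (simp add: exp_of_nat_mult)
  also have "\<dots> \<le> exp (real n / L * ln L)"
    using assms by (intro exp_le_cancel_iff[THEN iffD2] mult_right_mono) auto
  finally show ?thesis using assms
    by (simp add: add_divide_distrib distrib_left exp_add mult.commute mult.left_commute)
qed

text \<open>The crude bound \<open>((n - 2) / k) ^ k\<close> suffices. The condition
  \<open>n \<ge> 8\<close> is what puts \<open>3 / 2 * k\<close>, which is at most
  \<open>3 / 4 * n\<close>, below \<open>n - 2\<close>.\<close>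

lemma binomial_ge_powr:
  assumes "n \<ge> 8" "real k \<le> real n / 2" "r \<le> real k"
  shows "(3 / 2) powr r \<le> real ((n - 2) choose k)"
proof -
  have "(3 / 2) powr r \<le> (3 / 2) powr real k" using assms by (intro powr_mono) auto
  also have "\<dots> = (3 / 2) ^ k" by (simp add: powr_realpow)
  also have "\<dots> \<le> (real (n - 2) / real k) ^ k"
  proof (cases "k = 0")
    case False
    have "3 / 2 * real k \<le> real (n - 2)" using assms by (simp add: of_nat_diff)
    then show ?thesis using False by (intro power_mono) (auto simp: le_divide_eq)
  qed simp
  also have "\<dots> \<le> real ((n - 2) choose k)"
    using assms by (intro binomial_ge_n_over_k_pow_k) linarith
  finally show ?thesis .
qed

text \<open>The sets of each size contribute exactly 1. With these weights a union bound over all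
  sets costs only a linear factor.\<close>

lemma sum_Pow_inverse_binomial:
  assumes "finite X"
  shows "(\<Sum>S\<in>Pow X. 1 / real (card X choose card S)) = real (card X) + 1"
proof -
  have "(\<Sum>S\<in>Pow X. 1 / real (card X choose card S))
      = (\<Sum>k\<le>card X. \<Sum>S | S \<in> Pow X \<and> card S = k. 1 / real (card X choose card S))"
    using assms by (intro sum.group[symmetric]) (auto intro: card_mono)
  also have "\<dots> = (\<Sum>k\<le>card X. 1)"
    using assms by (intro sum.cong) (auto simp: n_subsets)
  finally show ?thesis by simp
qed

text \<open>The first summand is the rate of \<open>(4 * L) ^ A\<close> with \<open>A\<close> about
  \<open>\<theta> * n / (8 * L)\<close>, the second that of \<open>2 * m\<close> coefficients
  \<open>(n + D) choose D\<close> with \<open>D\<close> about \<open>n / L\<close>.\<close>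

lemma exists_large_scale:
  fixes \<theta> \<kappa> :: real
  assumes "\<kappa> > 0"
  shows "\<exists>L\<ge>1. \<theta> / (8 * L) * ln (4 * L) + 2 * real m * ((2 + ln L) / L) \<le> \<kappa>"
proof -
  have "((\<lambda>L. \<theta> / (8 * L) * ln (4 * L) + 2 * real m * ((2 + ln L) / L)) \<longlongrightarrow> 0) at_top"
    by real_asymp
  then have "\<forall>\<^sub>F L in at_top. \<theta> / (8 * L) * ln (4 * L) + 2 * real m * ((2 + ln L) / L) < \<kappa>"
    using assms by (rule order_tendstoD)
  from eventually_happens'[OF _ eventually_conj[OF this eventually_ge_at_top[of 1]]]
  show ?thesis by (auto intro: less_imp_le)
qed

lemma power_exp_smallo:
  assumes "\<kappa> > 0"
  shows "(\<lambda>n. C * real n ^ k * exp (- (\<kappa> * real n))) \<in> o(\<lambda>n. exp (- (\<kappa> / 2) * real n))"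
  using assms by real_asymp

section \<open>Degrees and cuts\<close>

text \<open>The complement is taken in the whole type, so that \<open>S\<close> can stay fixed while
  the vertex set grows. \<open>cut_verts\<close> identifies this with the cut in
  \<open>expansion\<close>.\<close>

abbreviation cutsize :: "'v set \<Rightarrow> 'v mgraph \<Rightarrow> nat" where
  "cutsize S G \<equiv> size (cut G S (- S))"

lemma cutsize_Compl: "cutsize (- S) G = cutsize S G"
proof -
  have "(\<exists>x\<in>- S. \<exists>y\<in>- (- S). e = {#x, y#}) \<longleftrightarrow> (\<exists>x\<in>S. \<exists>y\<in>- S. e = {#x, y#})" for e
    by (metis Compl_iff add_mset_commute double_complement)
  then show ?thesis by (simp add: cut_def)
qed

lemma edges_add_edge [simp]: "edges (add_edge u v G) = add_mset {#u, v#} (edges G)"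
  and verts_add_edge [simp]: "verts (add_edge u v G) = verts G"
  and edges_add_vertex [simp]: "edges (add_vertex v G) = edges G"
  and verts_add_vertex [simp]: "verts (add_vertex v G) = insert v (verts G)"
  by (simp_all add: add_edge_def add_vertex_def)

lemma mdegree_add_vertex [simp]: "mdegree (add_vertex v G) w = mdegree G w"
  by (simp add: mdegree_def)

lemma cutsize_add_vertex [simp]: "cutsize S (add_vertex v G) = cutsize S G"
  by (simp add: cut_def)

lemma mdegree_add_edge:
  "mdegree (add_edge u v G) w = mdegree G w + (if w = u then 1 else 0) + (if w = v then 1 else 0)"
  by (simp add: mdegree_def)

lemma cutsize_add_edge:
  "cutsize S (add_edge u v G) = cutsize S G + (if (u \<in> S) = (v \<in> S) then 0 else 1)"
proof -
  have "(\<exists>x\<in>S. \<exists>y\<in>- S. {#u, v#} = {#x, y#}) \<longleftrightarrow> (u \<in> S) \<noteq> (v \<in> S)"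
    by (auto simp: add_eq_conv_ex)
  then show ?thesis by (simp add: cut_def)
qed

lemma sum_mdegree_add_edge:
  assumes "finite T"
  shows "(\<Sum>w\<in>T. mdegree (add_edge u v G) w)
    = (\<Sum>w\<in>T. mdegree G w) + (if u \<in> T then 1 else 0) + (if v \<in> T then 1 else 0)"
  using assms by (simp add: mdegree_add_edge sum.distrib)

lemma cut_verts:
  assumes "\<And>e. e \<in># edges G \<Longrightarrow> set_mset e \<subseteq> verts G"
  shows "cut G S (verts G - S) = cut G S (- S)"
  unfolding cut_def by (rule filter_mset_cong) (use assms in fastforce)+

text \<open>The type of graphs is uncountable, and a measure on it need not be determined by its
  atoms. Here the atoms on a finite support already sum to 1, so nothing is left outside it.\<close>

lemma (in prob_space) distr_eq_measure_pmfI: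
  assumes X: "X \<in> measurable M (count_space UNIV)" and "finite (set_pmf p)"
    and eq: "\<And>y. y \<in> set_pmf p \<Longrightarrow> \<P>(x in M. X x = y) = pmf p y"
  shows "distr M (count_space UNIV) X = measure_pmf p"
proof (rule measure_eqI_countable_AE)
  have pred: "{x \<in> space M. X x = y} \<in> events" for y
    using measurable_sets[OF X, of "{y}"] by (simp add: vimage_def Int_def conj_commute)
  have "prob {x \<in> space M. X x \<in> set_pmf p} = (\<Sum>y\<in>set_pmf p. \<P>(x in M. X x = y))"
    using assms(2) pred by (subst finite_measure_finite_Union[symmetric])
      (auto simp: disjoint_family_on_def intro!: arg_cong[where f = prob])
  also have "\<dots> = 1" using eq assms(2) by (simp add: sum_pmf_eq_1)
  finally have "AE x in M. X x \<in> set_pmf p"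
    using prob_Collect_eq_1[of "\<lambda>x. X x \<in> set_pmf p"] measurable_sets[OF X, of "set_pmf p"]
    by (simp add: vimage_def Int_def conj_commute)
  then show "AE x in distr M (count_space UNIV) X. x \<in> set_pmf p"
    using X by (subst AE_distr_iff) auto
  show "emeasure (distr M (count_space UNIV) X) {y} = emeasure (measure_pmf p) {y}"
    if "y \<in> set_pmf p" for y
    using eq[OF that] X
    by (simp add: emeasure_distr emeasure_eq_measure emeasure_pmf_single vimage_def Int_def conj_commute)
qed (use assms(2) in \<open>auto simp: AE_measure_pmf_iff countable_finite\<close>)

section \<open>The invariants of the construction\<close>

locale pa_params =
  fixes M :: pa_model and m :: nat and \<delta> :: real and G\<^sub>0 :: "nat mgraph"
  assumes m_pos: "m > 0" and delta: "\<delta> > - real m"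
    and init: "multigraph G\<^sub>0" "verts G\<^sub>0 = {1, 2}"
    and init_pos: "real (mdegree G\<^sub>0 1) + \<delta> > 0" "real (mdegree G\<^sub>0 2) + \<delta> > 0"
begin

definition "deg0 = mdegree G\<^sub>0 1 + mdegree G\<^sub>0 2"

abbreviation "theta \<equiv> 2 * real m + \<delta>"

abbreviation "target v j G \<equiv> embed_pmf (attach_prob M m \<delta> deg0 v j G)"

text \<open>
  The last conjunct holds because an edge that does not cross the boundary of \<open>T\<close> adds to the
  degree of \<open>T\<close> only if it comes from an arriving vertex of \<open>T\<close>.
\<close>

definition attaching :: "nat \<Rightarrow> nat \<Rightarrow> nat mgraph \<Rightarrow> bool" where
  "attaching v j G \<longleftrightarrow>
     verts G = {1..v} \<and> (\<forall>e \<in># edges G. set_mset e \<subseteq> {1..v}) \<and>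
     (\<forall>u. 1 \<le> u \<and> u < v \<longrightarrow> real (mdegree G u) + \<delta> > 0) \<and>
     j \<le> mdegree G v \<and> (M = Model_d \<longrightarrow> mdegree G v = j) \<and>
     (\<Sum>u = 1..v. mdegree G u) = deg0 + 2 * m * (v - 3) + 2 * j \<and>
     (\<forall>T. (\<Sum>u\<in>T \<inter> {1..v}. mdegree G u)
        \<le> deg0 + 2 * m * card (T \<inter> {3..<v}) + (if v \<in> T then 2 * j else 0) + cutsize T G)"

text \<open>This is \<open>attaching\<close> at \<open>j = m\<close> with the newest vertex counted
  among the old ones, in a form that also covers the initial graph at \<open>n = 2\<close>.\<close>

definition complete :: "nat \<Rightarrow> nat mgraph \<Rightarrow> bool" where
  "complete n G \<longleftrightarrow>
     verts G = {1..n} \<and> (\<forall>e \<in># edges G. set_mset e \<subseteq> {1..n}) \<and>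
     (\<forall>u. 1 \<le> u \<and> u \<le> n \<longrightarrow> real (mdegree G u) + \<delta> > 0) \<and>
     (\<Sum>u = 1..n. mdegree G u) = deg0 + 2 * m * (n - 2) \<and>
     (\<forall>T. (\<Sum>u\<in>T \<inter> {1..n}. mdegree G u)
        \<le> deg0 + 2 * m * card (T \<inter> {3..n}) + cutsize T G)"

lemma complete_init: "complete 2 G\<^sub>0"
proof -
  have set: "{1..2} = {1, 2::nat}" by auto
  have "(\<Sum>u\<in>T \<inter> {1..2}. mdegree G\<^sub>0 u) \<le> (\<Sum>u\<in>{1, 2}. mdegree G\<^sub>0 u)" for T
    unfolding set by (rule sum_mono2) auto
  then have "(\<Sum>u\<in>T \<inter> {1..2}. mdegree G\<^sub>0 u) \<le> deg0" for T by (simp add: deg0_def)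
  then have "\<forall>T. (\<Sum>u\<in>T \<inter> {1..2}. mdegree G\<^sub>0 u) \<le> deg0 + 2 * m * card (T \<inter> {3..2}) + cutsize T G\<^sub>0"
    by (simp add: trans_le_add1)
  moreover have "\<forall>u. 1 \<le> u \<and> u \<le> 2 \<longrightarrow> real (mdegree G\<^sub>0 u) + \<delta> > 0"
    using init_pos set by (metis atLeastAtMost_iff insert_iff singletonD)
  moreover have "\<forall>e \<in># edges G\<^sub>0. set_mset e \<subseteq> {1..2}" "verts G\<^sub>0 = {1..2}"
    using init unfolding multigraph_def set by auto
  moreover have "(\<Sum>u = 1..2. mdegree G\<^sub>0 u) = deg0 + 2 * m * (2 - 2)"
    unfolding set by (simp add: deg0_def)
  ultimately show ?thesis unfolding complete_def by blast
qed

lemma attaching_add_vertex: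
  assumes "complete n G" "n \<ge> 2"
  shows "attaching (Suc n) 0 (add_vertex (Suc n) G)"
proof -
  have E: "\<forall>e \<in># edges G. set_mset e \<subseteq> {1..n}" using assms by (simp add: complete_def)
  then have "count e (Suc n) = 0" if "e \<in># edges G" for e
    using that by (force simp: count_eq_zero_iff)
  then have z: "mdegree G (Suc n) = 0" by (simp add: mdegree_def)
  have i: "{3..<Suc n} = {3..n}" by auto
  have s: "(\<Sum>u\<in>T \<inter> {1..Suc n}. mdegree G u) = (\<Sum>u\<in>T \<inter> {1..n}. mdegree G u)" for T
    using z by (intro sum.mono_neutral_right) (auto simp: le_Suc_eq)
  have "(\<Sum>u\<in>T \<inter> {1..Suc n}. mdegree G u) \<le> deg0 + 2 * m * card (T \<inter> {3..n}) + cutsize T G" for T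
    unfolding s using assms by (simp add: complete_def)
  moreover have "verts (add_vertex (Suc n) G) = {1..Suc n}" using assms by (auto simp: complete_def)
  ultimately show ?thesis using assms z E unfolding attaching_def i
    by (fastforce simp: complete_def)
qed

lemma complete_of_attaching:
  assumes "attaching (Suc n) m G" "n \<ge> 2"
  shows "complete (Suc n) G"
proof -
  have i: "card (T \<inter> {3..Suc n}) = card (T \<inter> {3..<Suc n}) + (if Suc n \<in> T then 1 else 0)" for T
  proof -
    have "T \<inter> {3..Suc n} = (T \<inter> {3..<Suc n}) \<union> (T \<inter> {Suc n})" using assms by auto
    then have "card (T \<inter> {3..Suc n}) = card (T \<inter> {3..<Suc n}) + card (T \<inter> {Suc n})"
      by (simp only:) (rule card_Un_disjoint; auto)
    then show ?thesis by simp
  qed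
  have "real (mdegree G u) + \<delta> > 0" if "1 \<le> u" "u \<le> Suc n" for u
  proof (cases "u = Suc n")
    case True
    \<comment> \<open>Each of the \<open>m\<close> edges adds at least 1 to the degree of the vertex
      that brings it, so \<open>\<delta> > - m\<close> makes the weight of this vertex
      positive.\<close>
    have "real m \<le> real (mdegree G u)" using assms True by (simp add: attaching_def)
    then show ?thesis using delta by linarith
  next
    case False
    then show ?thesis using that assms by (simp add: attaching_def)
  qed
  moreover have "(\<Sum>u\<in>T \<inter> {1..Suc n}. mdegree G u)
        \<le> deg0 + 2 * m * card (T \<inter> {3..Suc n}) + cutsize T G" for T
  proof -
    have "(\<Sum>u\<in>T \<inter> {1..Suc n}. mdegree G u)
        \<le> deg0 + 2 * m * card (T \<inter> {3..<Suc n}) + (if Suc n \<in> T then 2 * m else 0) + cutsize T G"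
      using assms unfolding attaching_def by blast
    then show ?thesis unfolding i by (auto simp: distrib_left)
  qed
  moreover have "2 * m * (Suc n - 2) = 2 * m * (Suc n - 3) + 2 * m"
  proof -
    have "Suc n - 2 = Suc (Suc n - 3)" using assms(2) by simp
    then show ?thesis by simp
  qed
  ultimately show ?thesis using assms unfolding complete_def
    by (simp add: attaching_def)
qed

text \<open>The degree bound for \<open>T\<close> survives in all four cases: if \<open>v\<close> is
  in \<open>T\<close>, the term \<open>2 * j\<close> grows by 2, which is the most that
  \<open>T\<close> can gain; if only \<open>u\<close> is in \<open>T\<close>, the gain of 1 is paid
  by the new crossing edge.\<close>

lemma attaching_add_edge:
  assumes "attaching v j G" "v \<ge> 3" "u \<in> {1..v}" "u = v \<longrightarrow> M \<noteq> Model_d"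
  shows "attaching v (Suc j) (add_edge u v G)"
proof -
  \<comment> \<open>\<open>u'\<close> stands for the end point \<open>u\<close>, whose name is
    captured by the summation.\<close>
  have "(\<Sum>u\<in>T \<inter> {1..v}. mdegree (add_edge u' v G) u)
      \<le> deg0 + 2 * m * card (T \<inter> {3..<v}) + (if v \<in> T then 2 * Suc j else 0)
        + cutsize T (add_edge u' v G)" if "u' = u" for T u'
  proof -
    have "(\<Sum>u\<in>T \<inter> {1..v}. mdegree G u)
        \<le> deg0 + 2 * m * card (T \<inter> {3..<v}) + (if v \<in> T then 2 * j else 0) + cutsize T G"
      using assms unfolding attaching_def by blast
    then show ?thesis using assms that
      by (auto simp: sum_mdegree_add_edge cutsize_add_edge)
  qed
  moreover have "(\<Sum>w = 1..v. mdegree (add_edge u v G) w) = deg0 + 2 * m * (v - 3) + 2 * Suc j"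
    using assms by (simp add: sum_mdegree_add_edge attaching_def)
  moreover have "\<forall>w. 1 \<le> w \<and> w < v \<longrightarrow> real (mdegree (add_edge u v G) w) + \<delta> > 0"
    using assms by (auto simp: mdegree_add_edge attaching_def add_pos_pos intro: add_strict_mono)
  ultimately show ?thesis using assms unfolding attaching_def
    by (auto simp: mdegree_add_edge)
qed

section \<open>Supports of the attachment laws\<close>

lemma pmf_target:
  assumes "attaching v j G" "v \<ge> 3" "j < m"
  shows "pmf (target v (Suc j) G) u = attach_prob M m \<delta> deg0 v (Suc j) G u"
proof (rule pmf_attach_prob)
  have "M = Model_d \<longrightarrow> mdegree G v = j" using assms unfolding attaching_def by blast
  then show "mdegree G v = Suc j - 1" if "M = Model_d" using that by simp
qed (use assms m_pos delta in \<open>auto simp: attaching_def\<close>)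

lemma set_pmf_target:
  assumes "attaching v j G" "v \<ge> 3" "j < m"
  shows "set_pmf (target v (Suc j) G) \<subseteq> {u \<in> {1..v}. u = v \<longrightarrow> M \<noteq> Model_d}"
  unfolding set_pmf_eq pmf_target[OF assms] using assms(2)
  by (auto simp: attach_prob_def split: if_splits)

lemma attach_edges_attaching:
  assumes "complete n G" "n \<ge> 2" "j \<le> m" "G' \<in> set_pmf (attach_edges M m \<delta> deg0 (Suc n) j G)"
  shows "attaching (Suc n) j G'"
  using assms(3,4)
proof (induction j arbitrary: G')
  case 0
  then show ?case using attaching_add_vertex assms by simp
next
  case (Suc j)
  then obtain H u where H: "H \<in> set_pmf (attach_edges M m \<delta> deg0 (Suc n) j G)"
    and u: "u \<in> set_pmf (target (Suc n) (Suc j) H)" and G': "G' = add_edge u (Suc n) H"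
    by (auto simp: attach_edge_def)
  have "attaching (Suc n) j H" using Suc H by simp
  then show ?case using attaching_add_edge set_pmf_target u Suc.prems assms(2) unfolding G'
    by fastforce
qed

lemma finite_attach_edges:
  assumes "complete n G" "n \<ge> 2" "j \<le> m"
  shows "finite (set_pmf (attach_edges M m \<delta> deg0 (Suc n) j G))"
  using assms(3)
proof (induction j)
  case (Suc j)
  have "finite (set_pmf (attach_edge M m \<delta> deg0 (Suc n) (Suc j) H))"
    if "H \<in> set_pmf (attach_edges M m \<delta> deg0 (Suc n) j G)" for H
  proof -
    have "attaching (Suc n) j H" using attach_edges_attaching assms that Suc by simp
    then have "finite (set_pmf (target (Suc n) (Suc j) H))"
      using set_pmf_target[of "Suc n" j H] Suc assms(2) by (auto intro: finite_subset)
    then show ?thesis by (simp add: attach_edge_def)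
  qed
  then show ?case using Suc by simp
qed simp

text \<open>\<open>pa_law k\<close> is the law of the graph with \<open>k + 2\<close> vertices. A
  chain of \<open>pmf\<close>s with finite supports allows expectations to be computed one edge at a
  time.\<close>

fun pa_law :: "nat \<Rightarrow> nat mgraph pmf" where
  "pa_law 0 = return_pmf G\<^sub>0"
| "pa_law (Suc k) = bind_pmf (pa_law k) (attach_edges M m \<delta> deg0 (Suc (Suc (Suc k))) m)"

lemma pa_law_complete: "G \<in> set_pmf (pa_law k) \<Longrightarrow> complete (Suc (Suc k)) G"
proof (induction k arbitrary: G)
  case 0
  then show ?case using complete_init by (simp add: numeral_2_eq_2)
next
  case (Suc k)
  then show ?case
    using attach_edges_attaching[of "Suc (Suc k)" _ m G]
    by (auto intro!: complete_of_attaching)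
qed

lemma finite_pa_law: "finite (set_pmf (pa_law k))"
  by (induction k) (use finite_attach_edges pa_law_complete in auto)

section \<open>The probability of a small cut\<close>

abbreviation "same_side S v \<equiv> (if v \<in> S then S else - S)"

text \<open>The bounded part of the weight of a side: the initial degrees, \<open>2 * m\<close> for
  the edges that the arriving vertex already has, twice \<open>\<bar>\<delta>\<bar>\<close> for the
  vertices 1 and 2, and \<open>1 + \<bar>\<delta>\<bar>\<close> from the self-weight.\<close>

definition "slack = real deg0 + 2 * real m + 3 * \<bar>\<delta>\<bar> + 1"

lemma theta_pos: "theta > 0"
  using delta m_pos by linarith

lemma pa_self_weight_le:
  assumes "Suc j \<le> m"
  shows "pa_self_weight M m \<delta> G v (Suc j) \<le> real (mdegree G v) + 1 + \<bar>\<delta>\<bar>"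
proof -
  have "r * \<delta> / real m \<le> \<bar>\<delta>\<bar>" if "0 \<le> r" "r \<le> real m" for r
  proof -
    have "r * \<delta> \<le> r * \<bar>\<delta>\<bar>" using that by (intro mult_left_mono) auto
    also have "\<dots> \<le> real m * \<bar>\<delta>\<bar>" using that by (intro mult_right_mono) auto
    finally have "r * \<delta> \<le> real m * \<bar>\<delta>\<bar>" .
    then show ?thesis using m_pos by (simp add: field_simps)
  qed
  from this[of "real (Suc j)"] this[of "real j"] show ?thesis
    using assms by (cases M) auto
qed

text \<open>The discarded terms are nonnegative: \<open>init_pos\<close> bounds the initial part,
  and \<open>\<delta> / m \<ge> - 1\<close> the contribution of the edges of \<open>v\<close>. The
  bound vanishes at \<open>v = 3\<close>, which therefore needs separate treatment.\<close>

lemma pa_norm_ge: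
  shows "theta * (real v - 3) \<le> pa_norm M m \<delta> deg0 v (Suc j)"
proof -
  have "- 1 \<le> \<delta> / real m" using delta m_pos by (simp add: field_simps)
  then have "r * - 1 \<le> r * (\<delta> / real m)" if "0 \<le> r" for r
    using that by (intro mult_left_mono)
  from this[of "real (Suc j)"] this[of "real j"]
  have "real (Suc j) * \<delta> / real m \<ge> - real (Suc j)" "real j * \<delta> / real m \<ge> - real j" by auto
  then show ?thesis using init_pos unfolding deg0_def by (cases M) auto
qed

text \<open>This is the degree invariant for the side \<open>T\<close> of \<open>v\<close>; its cut
  is that of \<open>S\<close> by symmetry. Every vertex of \<open>T\<close> in
  \<open>{3..<v}\<close> accounts for \<open>2 * m\<close> in the degree and \<open>\<delta>\<close>
  in the weight, hence for \<open>theta\<close>.\<close>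

lemma same_side_weight_le:
  fixes S :: "nat set"
  assumes "attaching v j G" "v \<ge> 3" "j < m"
  defines "T \<equiv> same_side S v"
  shows "(\<Sum>u\<in>T \<inter> {1..<v}. real (mdegree G u) + \<delta>) + pa_self_weight M m \<delta> G v (Suc j)
    \<le> theta * real (card (T \<inter> {3..<v})) + slack + real (cutsize S G)"
proof -
  have v: "v \<in> T" by (simp add: T_def)
  have cut: "cutsize T G = cutsize S G" using cutsize_Compl[of G S] by (simp add: T_def)
  have set: "T \<inter> {1..v} = insert v (T \<inter> {1..<v})" using v assms by auto
  have "(\<Sum>u\<in>T \<inter> {1..v}. mdegree G u)
      \<le> deg0 + 2 * m * card (T \<inter> {3..<v}) + (if v \<in> T then 2 * j else 0) + cutsize T G"
    using assms(1) unfolding attaching_def by blast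
  then have "(\<Sum>u\<in>T \<inter> {1..<v}. mdegree G u) + mdegree G v
      \<le> deg0 + 2 * m * card (T \<inter> {3..<v}) + 2 * j + cutsize S G"
    using v cut unfolding set by simp
  from of_nat_mono[OF this, where 'a = real]
  have deg: "(\<Sum>u\<in>T \<inter> {1..<v}. real (mdegree G u)) + real (mdegree G v)
      \<le> real deg0 + 2 * real m * card (T \<inter> {3..<v}) + 2 * real j + cutsize S G"
    by simp
  have "T \<inter> {1..<v} = (T \<inter> {3..<v}) \<union> (T \<inter> {1, 2})" using assms(2) by auto
  then have c: "card (T \<inter> {1..<v}) = card (T \<inter> {3..<v}) + card (T \<inter> {1, 2})"
    by (simp only:) (rule card_Un_disjoint; auto)
  have "card (T \<inter> {1, 2}) \<le> card {1, 2::nat}" by (intro card_mono) auto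
  then have r: "card (T \<inter> {1, 2}) \<le> 2" by simp
  have "\<delta> * real (card (T \<inter> {1, 2})) \<le> \<bar>\<delta>\<bar> * real (card (T \<inter> {1, 2}))"
    by (intro mult_right_mono) auto
  also have "\<dots> \<le> \<bar>\<delta>\<bar> * 2" using r by (intro mult_left_mono) auto
  finally have "\<delta> * real (card (T \<inter> {1, 2})) \<le> \<bar>\<delta>\<bar> * 2" .
  then have "\<delta> * real (card (T \<inter> {1..<v})) \<le> \<delta> * real (card (T \<inter> {3..<v})) + 2 * \<bar>\<delta>\<bar>"
    unfolding c by (simp add: distrib_left)
  moreover have "pa_self_weight M m \<delta> G v (Suc j) \<le> real (mdegree G v) + 1 + \<bar>\<delta>\<bar>"
    using pa_self_weight_le assms by simp
  ultimately show ?thesis using deg assms(3) unfolding slack_def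
    by (simp add: sum.distrib distrib_left distrib_right mult.commute[of _ \<delta>])
qed

lemma prob_same_side_le:
  fixes S :: "nat set"
  assumes "attaching v j G" "v \<ge> 4" "j < m"
  defines "T \<equiv> same_side S v"
  shows "measure_pmf.prob (target v (Suc j) G) T
    \<le> (theta * real (card (T \<inter> {3..<v})) + slack + real (cutsize S G)) / (theta * (real v - 3))"
proof -
  let ?p = "target v (Suc j) G" and ?c = "pa_norm M m \<delta> deg0 v (Suc j)"
  have v: "v \<in> T" by (simp add: T_def)
  have set: "T \<inter> {1..v} = insert v (T \<inter> {1..<v})" using v assms by auto
  have pos: "theta * (real v - 3) > 0" using theta_pos assms by simp
  have "measure_pmf.prob ?p T = measure_pmf.prob ?p (T \<inter> set_pmf ?p)"
    by (simp add: measure_Int_set_pmf)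
  also have "\<dots> \<le> measure_pmf.prob ?p (T \<inter> {1..v})"
    using set_pmf_target[of v j G] assms by (intro measure_pmf.finite_measure_mono) auto
  also have "\<dots> = (\<Sum>u\<in>T \<inter> {1..v}. attach_prob M m \<delta> deg0 v (Suc j) G u)"
    using assms by (simp add: measure_measure_pmf_finite pmf_target)
  also have "\<dots> = ((\<Sum>u\<in>T \<inter> {1..<v}. real (mdegree G u) + \<delta>)
      + pa_self_weight M m \<delta> G v (Suc j)) / ?c"
    unfolding set by (simp add: attach_prob_def add_divide_distrib sum_divide_distrib)
  also have "\<dots> \<le> (theta * real (card (T \<inter> {3..<v})) + slack + real (cutsize S G)) / ?c"
    using same_side_weight_le[of v j G S] assms(1-3) pos pa_norm_ge[of v j] unfolding T_def
    by (intro divide_right_mono) auto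
  also have "\<dots> \<le> (theta * real (card (T \<inter> {3..<v})) + slack + real (cutsize S G))
      / (theta * (real v - 3))"
    using pos pa_norm_ge[of v j] theta_pos
    by (intro divide_left_mono) (auto simp: slack_def intro!: mult_pos_pos add_nonneg_nonneg)
  finally show ?thesis .
qed

text \<open>The truncation discards the graphs for which the bound on the staying probability is too
  weak.\<close>

definition potential :: "real \<Rightarrow> nat \<Rightarrow> nat set \<Rightarrow> nat mgraph \<Rightarrow> real" where
  "potential x A S G = (if cutsize S G \<le> A then x ^ cutsize S G else 0)"

context
  fixes S :: "nat set" and A D n :: nat and x :: real
  assumes D: "D \<ge> 2" "D \<le> 2 * n" and x: "x = real D / (2 * real n)"
    and DA: "slack + real A \<le> theta * real D / 2"
begin

text \<open>An upper bound for the staying probability plus \<open>x\<close>. The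
  \<open>max 1\<close> replaces the zero denominator at \<open>v = 3\<close>.\<close>

definition "growth v = (real (card (same_side S v \<inter> {3..<v})) + real D) / max 1 (real v - 3)"

lemma x_bounds: "0 < x" "x \<le> 1"
  using D by (auto simp: x divide_le_eq)

lemma growth_nonneg: "growth v \<ge> 0"
  by (simp add: growth_def)

text \<open>A staying edge leaves the potential unchanged; a crossing edge multiplies it by
  \<open>x\<close> or makes it zero. So the expected factor is at most the staying probability plus
  \<open>x\<close>. One half of \<open>D\<close> absorbs \<open>slack + A\<close>, the other half
  absorbs \<open>x\<close>.\<close>

lemma potential_attach_edge:
  assumes "attaching v j G" "v \<ge> 3" "j < m" "v \<le> n"
  shows "(\<integral>\<^sup>+ H. ennreal (potential x A S H) \<partial>attach_edge M m \<delta> deg0 v (Suc j) G)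
    \<le> ennreal (growth v) * ennreal (potential x A S G)"
proof -
  let ?p = "target v (Suc j) G" and ?T = "same_side S v"
  have step: "potential x A S (add_edge u v G) \<le> potential x A S G * (indicator ?T u + x)" for u
    using x_bounds by (auto simp: potential_def cutsize_add_edge mult_ac indicator_def)
  have "measure_pmf.prob ?p ?T + x \<le> growth v" if A: "cutsize S G \<le> A"
  proof (cases "v = 3")
    case True
    \<comment> \<open>No vertex has been counted yet, so \<open>growth\<close> is just
      \<open>D\<close> here; \<open>D \<ge> 2\<close> covers the trivial bound.\<close>
    have "measure_pmf.prob ?p ?T + x \<le> 1 + 1" using x_bounds by (intro add_mono) auto
    also have "\<dots> \<le> growth v" using D True by (simp add: growth_def)
    finally show ?thesis .
  next
    case False
    let ?N = "real (card (?T \<inter> {3..<v}))"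
    have pos: "real v - 3 > 0" using assms False by simp
    have "measure_pmf.prob ?p ?T
        \<le> (theta * ?N + slack + real (cutsize S G)) / (theta * (real v - 3))"
      using prob_same_side_le[of v j G S] assms False by simp
    also have "\<dots> \<le> (theta * ?N + theta * real D / 2) / (theta * (real v - 3))"
      using A DA pos theta_pos by (intro divide_right_mono) auto
    also have "\<dots> = (theta * (?N + real D / 2)) / (theta * (real v - 3))"
      by (simp add: distrib_left)
    also have "\<dots> = (?N + real D / 2) / (real v - 3)"
      using theta_pos by (subst mult_divide_mult_cancel_left) auto
    finally have 1: "measure_pmf.prob ?p ?T \<le> (?N + real D / 2) / (real v - 3)" .
    \<comment> \<open>The choice of \<open>x\<close>: since \<open>v - 3 \<le> n\<close>, it costs
      at most the second half of \<open>D\<close> at every time.\<close>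
    have "x = (real D / 2) / real n" by (simp add: x)
    also have "\<dots> \<le> (real D / 2) / (real v - 3)"
      using pos assms by (intro divide_left_mono) auto
    finally have "measure_pmf.prob ?p ?T + x
        \<le> (?N + real D / 2) / (real v - 3) + (real D / 2) / (real v - 3)"
      using 1 by linarith
    also have "\<dots> = (?N + real D) / (real v - 3)"
      unfolding add_divide_distrib[symmetric] by (simp only: add.assoc field_sum_of_halves)
    also have "\<dots> = growth v" using assms False by (simp add: growth_def max_def)
    finally show ?thesis .
  qed
  then have bound: "potential x A S G * (measure_pmf.prob ?p ?T + x) \<le> growth v * potential x A S G"
    using x_bounds by (auto simp: potential_def)
  have nn: "potential x A S G \<ge> 0" using x_bounds by (simp add: potential_def)
  have "(\<integral>\<^sup>+ H. ennreal (potential x A S H) \<partial>attach_edge M m \<delta> deg0 v (Suc j) G)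
      = (\<integral>\<^sup>+ u. ennreal (potential x A S (add_edge u v G)) \<partial>?p)"
    by (simp add: attach_edge_def)
  also have "\<dots> \<le> (\<integral>\<^sup>+ u. ennreal (potential x A S G) * (indicator ?T u + ennreal x) \<partial>?p)"
  proof (intro nn_integral_mono)
    fix u
    have "ennreal (potential x A S (add_edge u v G))
        \<le> ennreal (potential x A S G * (indicator ?T u + x))"
      by (rule ennreal_leI[OF step])
    also have "\<dots> = ennreal (potential x A S G) * (indicator ?T u + ennreal x)"
      using nn x_bounds by (simp add: ennreal_mult ennreal_plus flip: ennreal_indicator)
    finally show "ennreal (potential x A S (add_edge u v G))
        \<le> ennreal (potential x A S G) * (indicator ?T u + ennreal x)" .
  qed
  also have "\<dots> = ennreal (potential x A S G) * (emeasure ?p ?T + ennreal x)"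
    by (simp add: nn_integral_cmult nn_integral_add measure_pmf.emeasure_space_1)
  also have "\<dots> = ennreal (potential x A S G * (measure_pmf.prob ?p ?T + x))"
    using nn x_bounds by (simp add: ennreal_mult ennreal_plus measure_pmf.emeasure_eq_measure)
  also have "\<dots> \<le> ennreal (growth v * potential x A S G)"
    by (rule ennreal_leI[OF bound])
  also have "\<dots> = ennreal (growth v) * ennreal (potential x A S G)"
    using nn growth_nonneg by (simp add: ennreal_mult)
  finally show ?thesis .
qed

lemma potential_attach_edges:
  assumes "complete k G" "k \<ge> 2" "Suc k \<le> n" "j \<le> m"
  shows "(\<integral>\<^sup>+ H. ennreal (potential x A S H) \<partial>attach_edges M m \<delta> deg0 (Suc k) j G)
    \<le> ennreal (growth (Suc k) ^ j) * ennreal (potential x A S G)"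
  using assms(4)
proof (induction j)
  case 0
  then show ?case by (simp add: potential_def)
next
  case (Suc j)
  let ?q = "attach_edges M m \<delta> deg0 (Suc k) j G"
  have "(\<integral>\<^sup>+ H. ennreal (potential x A S H) \<partial>attach_edges M m \<delta> deg0 (Suc k) (Suc j) G)
      = (\<integral>\<^sup>+ G'. (\<integral>\<^sup>+ H. ennreal (potential x A S H) \<partial>attach_edge M m \<delta> deg0 (Suc k) (Suc j) G') \<partial>?q)"
    by simp
  also have "\<dots> \<le> (\<integral>\<^sup>+ G'. ennreal (growth (Suc k)) * ennreal (potential x A S G') \<partial>?q)"
  proof (rule nn_integral_mono_AE, unfold AE_measure_pmf_iff, intro ballI)
    fix G' assume "G' \<in> set_pmf ?q"
    then have "attaching (Suc k) j G'" using attach_edges_attaching assms Suc by simp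
    then show "(\<integral>\<^sup>+ H. ennreal (potential x A S H) \<partial>attach_edge M m \<delta> deg0 (Suc k) (Suc j) G')
        \<le> ennreal (growth (Suc k)) * ennreal (potential x A S G')"
      using assms Suc by (intro potential_attach_edge) auto
  qed
  also have "\<dots> = ennreal (growth (Suc k)) * (\<integral>\<^sup>+ G'. ennreal (potential x A S G') \<partial>?q)"
    by (simp add: nn_integral_cmult)
  also have "\<dots> \<le> ennreal (growth (Suc k)) *
      (ennreal (growth (Suc k) ^ j) * ennreal (potential x A S G))"
    using Suc by (intro mult_left_mono) auto
  also have "\<dots> = ennreal (growth (Suc k) ^ Suc j) * ennreal (potential x A S G)"
    using growth_nonneg by (simp add: ennreal_mult mult.assoc)
  finally show ?case .
qed

text \<open>Each arriving vertex multiplies the rising factorial of its own side by that side's next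
  factor; the exponent \<open>m\<close> comes from its \<open>m\<close> edges, which share one value
  of \<open>growth\<close>.\<close>

lemma potential_pa_law:
  assumes "Suc (Suc k) \<le> n"
  shows "(\<integral>\<^sup>+ H. ennreal (potential x A S H) \<partial>pa_law k)
    \<le> ennreal ((pochhammer (real D) (card (S \<inter> {3..Suc (Suc k)}))
        * pochhammer (real D) (card (- S \<inter> {3..Suc (Suc k)})) / fact (k - 1)) ^ m)"
  using assms
proof (induction k)
  case 0
  have "potential x A S G\<^sub>0 \<le> 1" using x_bounds by (simp add: potential_def power_le_one)
  then show ?case using ennreal_leI by force
next
  case (Suc k)
  let ?v = "Suc (Suc (Suc k))"
  let ?P = "\<lambda>T k. pochhammer (real D) (card (T \<inter> {3..Suc (Suc k)}))"
  let ?R = "\<lambda>k. ?P S k * ?P (- S) k / fact (k - 1)"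
  have nn: "?R k \<ge> 0" for k
    using D by (intro divide_nonneg_nonneg mult_nonneg_nonneg pochhammer_nonneg) auto
  have i: "{3..<?v} = {3..Suc (Suc k)}" by auto
  have I: "?P T (Suc k) = (if ?v \<in> T then real D + card (T \<inter> {3..Suc (Suc k)}) else 1) * ?P T k" for T
  proof (cases "?v \<in> T")
    case True
    then have "T \<inter> {3..?v} = insert ?v (T \<inter> {3..Suc (Suc k)})" by auto
    then show ?thesis using True by (simp add: pochhammer_Suc mult.commute)
  next
    case False
    then have "T \<inter> {3..?v} = T \<inter> {3..Suc (Suc k)}" by (auto simp: le_Suc_eq)
    then show ?thesis using False by simp
  qed
  \<comment> \<open>The denominators for the vertices 3, 4, 5, 6 and so on are 1, 1, 2, 3 and so on;
    hence the factorial of \<open>k - 1\<close> and not of \<open>k\<close>.\<close>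
  have f: "fact (Suc k - 1) = max 1 (real ?v - 3) * (fact (k - 1) :: real)"
    by (cases k) (auto simp: max_def)
  have R: "?R (Suc k) = growth ?v * ?R k"
  proof -
    have "?P S (Suc k) * ?P (- S) (Suc k)
        = (real (card (same_side S ?v \<inter> {3..Suc (Suc k)})) + real D) * (?P S k * ?P (- S) k)"
      unfolding I by (simp add: algebra_simps)
    then show ?thesis unfolding f growth_def i by simp
  qed
  have "(\<integral>\<^sup>+ H. ennreal (potential x A S H) \<partial>pa_law (Suc k))
      = (\<integral>\<^sup>+ G. (\<integral>\<^sup>+ H. ennreal (potential x A S H) \<partial>attach_edges M m \<delta> deg0 ?v m G) \<partial>pa_law k)"
    by simp
  also have "\<dots> \<le> (\<integral>\<^sup>+ G. ennreal (growth ?v ^ m) * ennreal (potential x A S G) \<partial>pa_law k)"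
    using Suc.prems
    by (intro nn_integral_mono_AE) (auto simp: AE_measure_pmf_iff intro!: potential_attach_edges pa_law_complete)
  also have "\<dots> = ennreal (growth ?v ^ m) * (\<integral>\<^sup>+ G. ennreal (potential x A S G) \<partial>pa_law k)"
    by (simp add: nn_integral_cmult)
  also have "\<dots> \<le> ennreal (growth ?v ^ m) * ennreal (?R k ^ m)"
    using Suc by (intro mult_left_mono) auto
  also have "\<dots> = ennreal (?R (Suc k) ^ m)"
    unfolding R power_mult_distrib using nn growth_nonneg by (simp add: ennreal_mult)
  finally show ?case .
qed

text \<open>Markov's inequality: as \<open>x \<le> 1\<close>, the potential is at least
  \<open>x ^ A\<close> on the event.\<close>

lemma prob_small_cut:
  assumes "n = Suc (Suc k)"
  shows "measure_pmf.prob (pa_law k) {G. cutsize S G \<le> A}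
    \<le> (1 / x) ^ A * (pochhammer (real D) (card (S \<inter> {3..n}))
        * pochhammer (real D) (card (- S \<inter> {3..n})) / fact (k - 1)) ^ m"
    (is "_ \<le> _ * ?R")
proof -
  have "x ^ A * indicator {G. cutsize S G \<le> A} G \<le> potential x A S G" for G
    using x_bounds by (auto simp: potential_def intro!: power_decreasing)
  then have le: "ennreal (x ^ A) * indicator {G. cutsize S G \<le> A} G \<le> ennreal (potential x A S G)" for G
  proof -
    have "ennreal (x ^ A) * indicator {G. cutsize S G \<le> A} G
        = ennreal (x ^ A * indicator {G. cutsize S G \<le> A} G)"
      by (simp add: indicator_def)
    also have "\<dots> \<le> ennreal (potential x A S G)" by (rule ennreal_leI) fact
    finally show ?thesis .
  qed
  have "ennreal (x ^ A * measure_pmf.prob (pa_law k) {G. cutsize S G \<le> A})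
      = (\<integral>\<^sup>+ G. ennreal (x ^ A) * indicator {G. cutsize S G \<le> A} G \<partial>pa_law k)"
    using x_bounds by (simp add: nn_integral_cmult measure_pmf.emeasure_eq_measure ennreal_mult)
  also have "\<dots> \<le> (\<integral>\<^sup>+ G. ennreal (potential x A S G) \<partial>pa_law k)"
    by (intro nn_integral_mono le)
  also have "\<dots> \<le> ennreal ?R" using potential_pa_law[of k] assms by simp
  finally have "x ^ A * measure_pmf.prob (pa_law k) {G. cutsize S G \<le> A} \<le> ?R"
  proof (subst (asm) ennreal_le_iff)
    show "0 \<le> ?R" using D
      by (intro zero_le_power divide_nonneg_nonneg mult_nonneg_nonneg pochhammer_nonneg) auto
  qed
  then show ?thesis using x_bounds by (simp add: field_simps power_one_over)
qed

end

section \<open>The law of a preferential attachment sequence\<close>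

text \<open>The transition rule is given only relative to a full history. Summing over all histories
  leaves the one-step kernel at \<open>G n\<close>. Strong induction supplies finite supports for
  all earlier graphs, so finitely many histories suffice almost surely.\<close>

lemma distr_pa_sequence:
  assumes "pa_sequence M m \<delta> G\<^sub>0 \<Omega> G"
  shows "distr \<Omega> (count_space UNIV) (G (Suc (Suc k))) = measure_pmf (pa_law k)"
proof (induction k rule: less_induct)
  case (less k)
  from assms interpret prob_space \<Omega> by (simp add: pa_sequence_def)
  have meas: "G i \<in> measurable \<Omega> (count_space UNIV)" if "2 \<le> i" for i
    using assms that by (simp add: pa_sequence_def)
  note [measurable] = meas
  show ?case
  proof (cases k)
    case 0
    have "AE \<omega> in \<Omega>. G 2 \<omega> = G\<^sub>0" using assms by (simp add: pa_sequence_def)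
    then have "\<P>(\<omega> in \<Omega>. G 2 \<omega> = G\<^sub>0) = 1" by (intro prob_Collect_eq_1[THEN iffD2]) measurable
    then show ?thesis unfolding 0
      by (intro distr_eq_measure_pmfI) (auto simp: numeral_2_eq_2[symmetric] meas)
  next
    case (Suc l)
    define n where "n = Suc (Suc l)"
    have n: "n \<ge> 2" by (simp add: n_def)
    \<comment> \<open>Extensional functions, so that almost every outcome has exactly one history in
      this finite set.\<close>
    define H where "H = (\<Pi>\<^sub>E i\<in>{2..n}. set_pmf (pa_law (i - 2)))"
    have finH: "finite H" unfolding H_def by (intro finite_PiE) (auto simp: finite_pa_law)
    let ?E = "\<lambda>h \<omega>. \<forall>i\<in>{2..n}. G i \<omega> = h i"
    have E [measurable]: "Measurable.pred \<Omega> (?E h)" for h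
    proof -
      have "{\<omega> \<in> space \<Omega>. G i \<omega> = h i} \<in> events" if "i \<in> {2..n}" for i
        using measurable_sets[OF meas, of i "{h i}"] that
        by (simp add: vimage_def Int_def conj_commute)
      then show ?thesis unfolding pred_def by (intro sets.sets_Collect_finite_All) auto
    qed
    have supp: "AE \<omega> in \<Omega>. \<forall>i\<in>{2..n}. G i \<omega> \<in> set_pmf (pa_law (i - 2))"
    proof (intro AE_finite_allI)
      fix i assume i: "i \<in> {2..n}"
      then obtain j where j: "i = Suc (Suc j)" by (metis add_2_eq_Suc' atLeastAtMost_iff le_add_diff_inverse2)
      then have eq: "distr \<Omega> (count_space UNIV) (G i) = measure_pmf (pa_law j)"
        using less i Suc by (simp add: n_def)
      have "AE g in distr \<Omega> (count_space UNIV) (G i). g \<in> set_pmf (pa_law j)"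
        unfolding eq AE_measure_pmf_iff by simp
      then have "AE \<omega> in \<Omega>. G i \<omega> \<in> set_pmf (pa_law j)"
        by (rule AE_distrD[rotated]) (use i in \<open>auto intro!: meas\<close>)
      then show "AE \<omega> in \<Omega>. G i \<omega> \<in> set_pmf (pa_law (i - 2))"
        by (simp add: j)
    qed simp
    have uniq: "\<exists>!h\<in>H. ?E h \<omega>" if "\<forall>i\<in>{2..n}. G i \<omega> \<in> set_pmf (pa_law (i - 2))" for \<omega>
    proof (rule ex1I)
      show "restrict (\<lambda>i. G i \<omega>) {2..n} \<in> H \<and> ?E (restrict (\<lambda>i. G i \<omega>) {2..n}) \<omega>"
        using that by (auto simp: H_def)
      show "h = restrict (\<lambda>i. G i \<omega>) {2..n}" if "h \<in> H \<and> ?E h \<omega>" for h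
        using that by (auto simp: H_def PiE_def extensional_def restrict_def fun_eq_iff)
    qed
    have law: "\<P>(\<omega> in \<Omega>. G (Suc n) \<omega> = g) = pmf (pa_law k) g" for g
    proof -
      let ?f = "\<lambda>g'. pmf (attach_edges M m \<delta> deg0 (Suc n) m g') g"
      have "\<P>(\<omega> in \<Omega>. G (Suc n) \<omega> = g) = (\<Sum>h\<in>H. \<P>(\<omega> in \<Omega>. ?E h \<omega> \<and> G (Suc n) \<omega> = g))"
      proof (rule prob_sum[OF finH])
        have *: "Measurable.pred \<Omega> (\<lambda>\<omega>. G (Suc n) \<omega> = g)" using n by (auto intro!: pred_eq_const1 meas)
        then show "{\<omega> \<in> space \<Omega>. G (Suc n) \<omega> = g} \<in> events" by measurable
        show "{\<omega> \<in> space \<Omega>. ?E h \<omega> \<and> G (Suc n) \<omega> = g} \<in> events" for h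
          using * by measurable
        show "AE \<omega> in \<Omega>. (\<forall>h\<in>H. ?E h \<omega> \<and> G (Suc n) \<omega> = g \<longrightarrow> G (Suc n) \<omega> = g) \<and>
          (G (Suc n) \<omega> = g \<longrightarrow> (\<exists>!h\<in>H. ?E h \<omega> \<and> G (Suc n) \<omega> = g))"
          using supp
        proof eventually_elim
          case (elim \<omega>)
          then show ?case using uniq[OF elim] by blast
        qed
      qed
      also have "\<dots> = (\<Sum>h\<in>H. \<P>(\<omega> in \<Omega>. ?E h \<omega>) * ?f (h n))"
        using assms n by (intro sum.cong) (auto simp: pa_sequence_def deg0_def)
      \<comment> \<open>Written as integrals, the sum can be taken pointwise, where only the actual
        history of the outcome survives.\<close>
      also have "\<dots> = (\<Sum>h\<in>H. \<integral>\<omega>. indicator {\<omega> \<in> space \<Omega>. ?E h \<omega>} \<omega> * ?f (h n) \<partial>\<Omega>)"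
        by (intro sum.cong) (auto simp: Int_absorb1)
      also have "\<dots> = (\<integral>\<omega>. (\<Sum>h\<in>H. indicator {\<omega> \<in> space \<Omega>. ?E h \<omega>} \<omega> * ?f (h n)) \<partial>\<Omega>)"
        by (intro Bochner_Integration.integral_sum[symmetric]) (simp add: less_top[symmetric])
      also have "\<dots> = (\<integral>\<omega>. ?f (G n \<omega>) \<partial>\<Omega>)"
      proof (rule integral_cong_AE)
        show "(\<lambda>\<omega>. \<Sum>h\<in>H. indicator {\<omega> \<in> space \<Omega>. ?E h \<omega>} \<omega> * ?f (h n)) \<in> borel_measurable \<Omega>"
          by measurable
        show "(\<lambda>\<omega>. ?f (G n \<omega>)) \<in> borel_measurable \<Omega>"
          using n by (intro measurable_compose[OF meas]) auto
        show "AE \<omega> in \<Omega>. (\<Sum>h\<in>H. indicator {\<omega> \<in> space \<Omega>. ?E h \<omega>} \<omega> * ?f (h n)) = ?f (G n \<omega>)"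
          using supp AE_space
        proof eventually_elim
          case (elim \<omega>)
          from uniq[OF elim(1)] obtain h where h: "h \<in> H" "?E h \<omega>"
            and only: "\<And>h'. h' \<in> H \<Longrightarrow> ?E h' \<omega> \<Longrightarrow> h' = h" by blast
          have "indicator {\<omega> \<in> space \<Omega>. ?E h' \<omega>} \<omega> * ?f (h' n) = (if h' = h then ?f (h n) else 0)"
            if "h' \<in> H" for h'
          proof (cases "h' = h")
            case True
            have "\<omega> \<in> {\<omega> \<in> space \<Omega>. ?E h \<omega>}" using h(2) elim(2) by blast
            then have "indicator {\<omega> \<in> space \<Omega>. ?E h \<omega>} \<omega> = (1 :: real)" by (rule indicator_simps(1))
            then show ?thesis
              unfolding True by (simp only: mult_1 if_True simp_thms)
          next
            case False
            then have "\<omega> \<notin> {\<omega> \<in> space \<Omega>. ?E h' \<omega>}" using only[OF that] by blast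
            then have "indicator {\<omega> \<in> space \<Omega>. ?E h' \<omega>} \<omega> = (0 :: real)" by (rule indicator_simps(2))
            with False show ?thesis
              by (simp only: mult_zero_left if_False)
          qed
          then have "(\<Sum>h'\<in>H. indicator {\<omega> \<in> space \<Omega>. ?E h' \<omega>} \<omega> * ?f (h' n))
              = (\<Sum>h'\<in>H. if h' = h then ?f (h n) else 0)"
            by (rule sum.cong[OF refl])
          also have "\<dots> = ?f (h n)" using h(1) finH by simp
          also have "h n = G n \<omega>" using h(2) n by (metis atLeastAtMost_iff order_refl)
          finally show ?case .
        qed
      qed
      also have "\<dots> = (\<integral>g'. ?f g' \<partial>distr \<Omega> (count_space UNIV) (G n))"
        using n by (intro integral_distr[symmetric] meas) auto
      also have "\<dots> = (\<integral>g'. ?f g' \<partial>measure_pmf (pa_law l))"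
        using less[of l] Suc by (simp add: n_def)
      also have "\<dots> = pmf (pa_law k) g"
        by (simp add: Suc pmf_bind n_def)
      finally show ?thesis .
    qed
    show ?thesis
      using law n by (intro distr_eq_measure_pmfI) (auto simp: Suc n_def finite_pa_law intro!: meas simp del: pa_law.simps)
  qed
qed

section \<open>Large-set expansion\<close>

text \<open>Of the \<open>m \<ge> 2\<close> inverse binomial coefficients, one is at most
  \<open>1 / q\<close>, and another serves as the weight that makes the sum over \<open>S\<close> at
  most \<open>n\<close>. The factor 4 counts the sets \<open>U\<close>.\<close>

lemma prob_exists_small_cut:
  fixes n A D :: nat and q x :: real
  assumes "m \<ge> 2" "n \<ge> 3" "D \<ge> 2" "D \<le> 2 * n" and x: "x = real D / (2 * real n)"
    and DA: "slack + real A \<le> theta * real D / 2"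
    and F: "F \<subseteq> Pow {3..n}" "\<And>S. S \<in> F \<Longrightarrow> q \<le> real ((n - 2) choose card S)" and "q > 0"
  shows "measure_pmf.prob (pa_law (n - 2)) {G. \<exists>U\<subseteq>{1, 2}. \<exists>S\<in>F. cutsize (U \<union> S) G \<le> A}
    \<le> 4 * real n / q * (1 / x) ^ A * (real n * (real ((n + D) choose D))\<^sup>2) ^ m"
    (is "measure_pmf.prob ?p _ \<le> 4 * _ / _ * _ * ?K ^ m")
proof -
  define k where "k = n - 2"
  have k: "k \<ge> 1" "n = Suc (Suc k)" using assms(2) by (auto simp: k_def)
  have xpos: "x > 0" using assms by simp
  let ?C = "real ((n + D) choose D)" and ?b = "\<lambda>S::nat set. real (k choose card S)"
  have Kpos: "?K \<ge> 0" by simp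
  have single: "measure_pmf.prob ?p {G. cutsize (U \<union> S) G \<le> A}
      \<le> (1 / x) ^ A * ?K ^ m * (1 / q) * (1 / ?b S)" if U: "U \<subseteq> {1, 2}" and S: "S \<in> F" for U S
  proof -
    have S3: "S \<subseteq> {3..n}" using F S by auto
    let ?s = "card S"
    have "?s \<le> card {3..n}" using S3 by (intro card_mono) auto
    then have s: "?s \<le> k" using k by simp
    then have b1: "?b S \<ge> 1" by (simp add: Suc_le_eq)
    have bq: "?b S \<ge> q" using F(2)[OF S] by (simp add: k_def)
    have "(U \<union> S) \<inter> {3..n} = S" using U S3 by fastforce
    moreover have "- (U \<union> S) \<inter> {3..n} = {3..n} - S" using U by fastforce
    moreover have "card ({3..n} - S) = k - ?s"
      using S3 k by (subst card_Diff_subset) (auto intro: finite_subset)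
    ultimately have "measure_pmf.prob ?p {G. cutsize (U \<union> S) G \<le> A}
        \<le> (1 / x) ^ A * (pochhammer (real D) ?s * pochhammer (real D) (k - ?s) / fact (k - 1)) ^ m"
      using prob_small_cut[OF assms(3,4) x DA k(2), of "U \<union> S"] by (simp add: k_def)
    also have "\<dots> \<le> (1 / x) ^ A * (?K / ?b S) ^ m"
    proof (intro mult_left_mono power_mono)
      have p: "pochhammer (real D) i \<le> fact i * ?C" if "i \<le> k" for i
      proof -
        have "(i + D choose D) \<le> (n + D choose D)"
          using that k by (intro binomial_right_mono) simp
        then have "fact i * real (i + D choose D) \<le> fact i * ?C"
          by (intro mult_left_mono) auto
        then show ?thesis using pochhammer_le_fact_binomial[of D i] assms by linarith
      qed
      have "pochhammer (real D) ?s * pochhammer (real D) (k - ?s)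
          \<le> (fact ?s * ?C) * (fact (k - ?s) * ?C)"
        using s assms by (intro mult_mono p pochhammer_nonneg) auto
      also have "\<dots> = (fact ?s * fact (k - ?s)) * ?C\<^sup>2" by (simp add: power2_eq_square)
      also have "fact ?s * fact (k - ?s) = fact k / ?b S"
        using arg_cong[OF binomial_fact_lemma[OF s], of real] b1 s by (simp add: eq_divide_eq)
      \<comment> \<open>The denominator is one factor short of \<open>fact k\<close>; this is the
        source of the factor \<open>n\<close> in \<open>?K\<close>.\<close>
      also have "fact k = real k * fact (k - 1)" using k by (subst fact_reduce) auto
      finally have "pochhammer (real D) ?s * pochhammer (real D) (k - ?s) / fact (k - 1)
          \<le> real k * ?C\<^sup>2 / ?b S"
        by (simp add: divide_le_eq mult_ac)
      also have "\<dots> \<le> ?K / ?b S"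
        using k b1 by (intro divide_right_mono mult_right_mono) auto
      finally show "pochhammer (real D) ?s * pochhammer (real D) (k - ?s) / fact (k - 1) \<le> ?K / ?b S" .
      show "0 \<le> pochhammer (real D) ?s * pochhammer (real D) (k - ?s) / fact (k - 1)"
        using assms by (intro divide_nonneg_nonneg mult_nonneg_nonneg pochhammer_nonneg) auto
    qed (use xpos in simp)
    also have "(?K / ?b S) ^ m = ?K ^ m * (1 / ?b S) ^ m" by (simp add: power_divide)
    also have "(1 / x) ^ A * (?K ^ m * (1 / ?b S) ^ m) \<le> (1 / x) ^ A * (?K ^ m * (1 / q * (1 / ?b S)))"
    proof (intro mult_left_mono)
      have "(1 / ?b S) ^ m \<le> (1 / ?b S) ^ 2"
        using b1 assms(1) by (intro power_decreasing) (auto simp: divide_le_eq)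
      also have "\<dots> \<le> 1 / q * (1 / ?b S)"
        unfolding power2_eq_square using bq b1 s \<open>q > 0\<close>
        by (intro mult_right_mono divide_left_mono mult_pos_pos) auto
      finally show "(1 / ?b S) ^ m \<le> 1 / q * (1 / ?b S)" .
    qed (use xpos Kpos in auto)
    finally show ?thesis by (simp add: mult.assoc)
  qed
  let ?I = "Pow {1, 2::nat} \<times> F" and ?W = "(1 / x) ^ A * ?K ^ m * (1 / q)"
  have finF: "finite F" using F(1) by (rule finite_subset) simp
  have "{G. \<exists>U\<subseteq>{1, 2}. \<exists>S\<in>F. cutsize (U \<union> S) G \<le> A}
      = (\<Union>(U, S)\<in>?I. {G. cutsize (U \<union> S) G \<le> A})" by auto
  then have "measure_pmf.prob ?p {G. \<exists>U\<subseteq>{1, 2}. \<exists>S\<in>F. cutsize (U \<union> S) G \<le> A}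
      \<le> (\<Sum>(U, S)\<in>?I. measure_pmf.prob ?p {G. cutsize (U \<union> S) G \<le> A})"
    using finF measure_pmf.finite_measure_subadditive_finite[of ?I
      "\<lambda>(U, S). {G. cutsize (U \<union> S) G \<le> A}" ?p] by (simp add: case_prod_unfold)
  also have "\<dots> \<le> (\<Sum>(U, S)\<in>?I. ?W * (1 / ?b S))"
    by (intro sum_mono) (use single in fastforce)
  also have "\<dots> = (\<Sum>U\<in>Pow {1, 2::nat}. \<Sum>S\<in>F. ?W * (1 / ?b S))"
    by (rule sum.cartesian_product[symmetric])
  also have "\<dots> = 4 * ?W * (\<Sum>S\<in>F. 1 / ?b S)"
    by (simp add: card_Pow sum_distrib_left)
  also have "\<dots> \<le> 4 * ?W * real n"
  proof (intro mult_left_mono)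
    have "(\<Sum>S\<in>F. 1 / ?b S) \<le> (\<Sum>S\<in>Pow {3..n}. 1 / ?b S)"
      using F(1) by (intro sum_mono2) auto
    also have "\<dots> = real k + 1"
      using sum_Pow_inverse_binomial[of "{3..n}"] k by simp
    finally show "(\<Sum>S\<in>F. 1 / ?b S) \<le> real n" using k by simp
  qed (use xpos Kpos \<open>q > 0\<close> in auto)
  finally show ?thesis by (simp add: mult_ac)
qed

text \<open>Removing the vertices 1 and 2 from a set with a bad ratio loses at most two elements,
  hence the \<open>- 2\<close>.\<close>

lemma small_expansion_cut:
  assumes "complete n G" "n \<ge> 1" "expansion G \<epsilon> < ereal \<alpha>" "\<epsilon> > 0" "\<alpha> > 0"
  shows "\<exists>U\<subseteq>{1, 2}. \<exists>S\<in>{S. S \<subseteq> {3..n} \<and> \<epsilon> * real n - 2 \<le> real (card S) \<and> real (card S) \<le> real n / 2}.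
    cutsize (U \<union> S) G \<le> nat \<lfloor>\<alpha> * real n\<rfloor>"
proof -
  have V: "verts G = {1..n}" and E: "\<And>e. e \<in># edges G \<Longrightarrow> set_mset e \<subseteq> verts G"
    using assms by (auto simp: complete_def)
  obtain T where T: "T \<subseteq> {1..n}" "\<epsilon> * real n \<le> real (card T)" "real (card T) \<le> real n / 2"
    and less: "ereal (real (size (cut G T (verts G - T))) / real (card T)) < ereal \<alpha>"
    using assms(3) unfolding expansion_def INF_less_iff V by auto
  \<comment> \<open>The set must be nonempty before the ratio can be cleared, because division by
    zero gives 0.\<close>
  have "\<epsilon> * real n > 0" using assms by simp
  then have "real (card T) > 0" using T by linarith
  then have "real (cutsize T G) < \<alpha> * real (card T)"
    using less by (simp add: cut_verts[OF E] divide_less_eq)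
  also have "\<dots> \<le> \<alpha> * real n" using T assms by (intro mult_left_mono) auto
  finally have c: "cutsize T G \<le> nat \<lfloor>\<alpha> * real n\<rfloor>" by linarith
  have fin: "finite T" using T finite_subset by blast
  have split: "T = (T \<inter> {1, 2}) \<union> (T \<inter> {3..n})" using T by fastforce
  have "card T \<le> card (T \<inter> {1, 2}) + card (T \<inter> {3..n})"
    by (subst split) (rule card_Un_le)
  moreover have "card (T \<inter> {1, 2}) \<le> card {1, 2::nat}" by (intro card_mono) auto
  moreover have "card (T \<inter> {3..n}) \<le> card T" using fin by (intro card_mono) auto
  ultimately have "\<epsilon> * real n - 2 \<le> real (card (T \<inter> {3..n}))" "real (card (T \<inter> {3..n})) \<le> real n / 2"
    using T by auto
  then show ?thesis using c split by (intro exI[of _ "T \<inter> {1, 2}"] conjI bexI[of _ "T \<inter> {3..n}"]) auto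
qed

lemma prob_small_expansion:
  assumes "m \<ge> 2" "\<epsilon> > 0"
  shows "\<exists>\<alpha>>0. \<exists>\<kappa>>0. \<forall>\<^sub>F n in sequentially.
    measure_pmf.prob (pa_law (n - 2)) {G. expansion G \<epsilon> < ereal \<alpha>}
      \<le> 9 * real n ^ Suc m * exp (- (\<kappa> * real n))"
proof -
  \<comment> \<open>Half of the rate at which \<open>q\<close> grows; the other half is left for the
    losses controlled by \<open>L\<close>.\<close>
  define \<kappa> where "\<kappa> = \<epsilon> * ln (3 / 2) / 2"
  have \<kappa>: "\<kappa> > 0" using assms by (simp add: \<kappa>_def)
  obtain L where L: "L \<ge> 1" "theta / (8 * L) * ln (4 * L) + 2 * real m * ((2 + ln L) / L) \<le> \<kappa>"
    using exists_large_scale[OF \<kappa>] by blast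
  \<comment> \<open>With \<open>D \<ge> n / (2 * L)\<close> this makes
    \<open>2 * \<alpha> * n\<close> at most \<open>theta * D / 2\<close>: one share
    \<open>\<alpha> * n\<close> for the cut, one for \<open>slack\<close>.\<close>
  define \<alpha> where "\<alpha> = theta / (8 * L)"
  have \<alpha>: "\<alpha> > 0" using theta_pos L by (simp add: \<alpha>_def)
  \<comment> \<open>The summands give, in this order, \<open>n \<ge> 8\<close> for the binomial
    bound, \<open>n / L \<ge> 4\<close> for the rounding of \<open>D\<close>, and
    \<open>slack \<le> \<alpha> * n\<close>.\<close>
  have "\<forall>\<^sub>F n in sequentially. n \<ge> nat \<lceil>8 + 4 * L + slack / \<alpha>\<rceil>" by (rule eventually_ge_at_top)
  then have "\<forall>\<^sub>F n in sequentially. measure_pmf.prob (pa_law (n - 2)) {G. expansion G \<epsilon> < ereal \<alpha>}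
      \<le> 9 * real n ^ Suc m * exp (- (\<kappa> * real n))"
  proof eventually_elim
    case (elim n)
    have slack: "slack \<ge> 0" by (simp add: slack_def)
    then have q0: "slack / \<alpha> \<ge> 0" using \<alpha> by simp
    have big: "8 + 4 * L + slack / \<alpha> \<le> real n" using elim by linarith
    have "8 \<le> real n" "4 * L \<le> real n" "slack / \<alpha> \<le> real n" using big L q0 by linarith+
    then have n8: "n \<ge> 8" and n4: "4 \<le> real n / L" and "slack / \<alpha> \<le> real n"
      using L by (auto simp: le_divide_eq)
    then have sl: "slack \<le> \<alpha> * real n" using \<alpha> by (simp add: divide_le_eq mult.commute)
    define A where "A = nat \<lfloor>\<alpha> * real n\<rfloor>"
    define D where "D = nat \<lfloor>real n / L\<rfloor>"
    define x where "x = real D / (2 * real n)"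
    define q where "q = (3 / 2 :: real) powr (\<epsilon> * real n - 2)"
    define F where "F = {S. S \<subseteq> {3..n} \<and> \<epsilon> * real n - 2 \<le> real (card S) \<and> real (card S) \<le> real n / 2}"
    have D1: "real D \<le> real n / L" and D2: "real n / L \<le> real D + 1" using n4 by (auto simp: D_def)
    have D3: "real n / (2 * L) \<le> real D" and D4: "D \<ge> 2" using D2 n4 by auto
    have "real n / L \<le> real n" using L by (simp add: divide_le_eq mult_le_cancel_left1)
    then have D5: "D \<le> 2 * n" using D1 by linarith
    have A: "real A \<le> \<alpha> * real n" using \<alpha> by (simp add: A_def)
    have "2 * (\<alpha> * real n) = theta * (real n / (2 * L)) / 2" by (simp add: \<alpha>_def)
    also have "\<dots> \<le> theta * real D / 2"
      using D3 theta_pos by (intro divide_right_mono mult_left_mono) auto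
    finally have DA: "slack + real A \<le> theta * real D / 2" using A sl by linarith
    have xpos: "x > 0" using D4 n8 by (simp add: x_def)
    have "measure_pmf.prob (pa_law (n - 2)) {G. expansion G \<epsilon> < ereal \<alpha>}
        \<le> measure_pmf.prob (pa_law (n - 2)) {G. \<exists>U\<subseteq>{1, 2}. \<exists>S\<in>F. cutsize (U \<union> S) G \<le> A}"
    proof (rule measure_pmf.finite_measure_mono_AE)
      show "AE G in pa_law (n - 2). G \<in> {G. expansion G \<epsilon> < ereal \<alpha>} \<longrightarrow>
          G \<in> {G. \<exists>U\<subseteq>{1, 2}. \<exists>S\<in>F. cutsize (U \<union> S) G \<le> A}"
        unfolding AE_measure_pmf_iff mem_Collect_eq
      proof (intro ballI impI)
        fix G assume "G \<in> set_pmf (pa_law (n - 2))" "expansion G \<epsilon> < ereal \<alpha>"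
        moreover have "Suc (Suc (n - 2)) = n" using n8 by simp
        ultimately have "complete n G" "expansion G \<epsilon> < ereal \<alpha>" using pa_law_complete by metis+
        then show "\<exists>U\<subseteq>{1, 2}. \<exists>S\<in>F. cutsize (U \<union> S) G \<le> A"
          using n8 \<alpha> assms unfolding F_def A_def by (intro small_expansion_cut) auto
      qed
    qed simp
    also have "\<dots> \<le> 4 * real n / q * (1 / x) ^ A * (real n * (real ((n + D) choose D))\<^sup>2) ^ m"
    proof (rule prob_exists_small_cut[OF assms(1) _ D4 D5 x_def DA])
      show "q \<le> real (n - 2 choose card S)" if "S \<in> F" for S
        using that n8 unfolding F_def q_def by (intro binomial_ge_powr) auto
    qed (use n8 in \<open>auto simp: F_def q_def\<close>)
    also have "\<dots> \<le> 4 * real n / q * exp (\<alpha> * real n * ln (4 * L))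
        * (real n * (exp (real n * ((2 + ln L) / L)))\<^sup>2) ^ m"
    proof (intro mult_mono mult_left_mono power_mono)
      have "1 / x = 2 * real n / real D" by (simp add: x_def)
      also have "\<dots> \<le> 2 * real n / (real n / (2 * L))"
        using D3 D4 L n8 by (intro divide_left_mono) (auto intro!: mult_pos_pos divide_pos_pos)
      also have "\<dots> = 4 * L" using n8 by simp
      finally have "1 / x \<le> 4 * L" .
      then have "(1 / x) ^ A \<le> (4 * L) ^ A" using xpos by (intro power_mono) auto
      also have "\<dots> = exp (real A * ln (4 * L))" using L by (simp add: exp_of_nat_mult)
      also have "\<dots> \<le> exp (\<alpha> * real n * ln (4 * L))"
        using A L by (intro exp_le_cancel_iff[THEN iffD2] mult_right_mono) auto
      finally show "(1 / x) ^ A \<le> exp (\<alpha> * real n * ln (4 * L))" .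
      show "real ((n + D) choose D) \<le> exp (real n * ((2 + ln L) / L))"
        by (rule binomial_add_le_exp[OF L(1) D1])
    qed (use xpos in \<open>auto simp: q_def\<close>)
    \<comment> \<open>The two lost elements cost \<open>(3 / 2)\<close> squared, so the 4 in front
      becomes 9.\<close>
    also have "q = exp (2 * \<kappa> * real n) * (4 / 9)"
      by (simp add: q_def powr_def \<kappa>_def left_diff_distrib exp_diff mult_ac
        flip: exp_of_nat_mult) (simp add: exp_double power2_eq_square)
    also have "(real n * (exp (real n * ((2 + ln L) / L)))\<^sup>2) ^ m
        = real n ^ m * exp (2 * real m * (real n * ((2 + ln L) / L)))"
      by (simp only: power_mult_distrib exp_of_nat_mult[symmetric] power_mult[symmetric] of_nat_mult)
        (simp add: mult_ac)
    also have "4 * real n / (exp (2 * \<kappa> * real n) * (4 / 9)) * exp (\<alpha> * real n * ln (4 * L))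
          * (real n ^ m * exp (2 * real m * (real n * ((2 + ln L) / L))))
        = 9 * real n ^ Suc m * (exp (\<alpha> * real n * ln (4 * L))
          * exp (2 * real m * (real n * ((2 + ln L) / L))) / exp (2 * \<kappa> * real n))"
      by simp
    also have "\<dots> = 9 * real n ^ Suc m * exp ((\<alpha> * ln (4 * L) + 2 * real m * ((2 + ln L) / L) - 2 * \<kappa>) * real n)"
      by (simp add: exp_add[symmetric] exp_diff[symmetric] algebra_simps)
    also have "\<dots> \<le> 9 * real n ^ Suc m * exp (- (\<kappa> * real n))"
    proof -
      have "(\<alpha> * ln (4 * L) + 2 * real m * ((2 + ln L) / L) - 2 * \<kappa>) * real n \<le> (- \<kappa>) * real n"
        using L(2) unfolding \<alpha>_def by (intro mult_right_mono) auto
      then show ?thesis by (intro mult_left_mono) auto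
    qed
    finally show ?case .
  qed
  then show ?thesis using \<alpha> \<kappa> by blast
qed

lemma avg_degree_le:
  assumes "complete n G" "n \<ge> 2"
  shows "avg_degree G \<le> real deg0 + 2 * real m"
proof -
  have V: "verts G = {1..n}" and deg: "(\<Sum>v = 1..n. mdegree G v) = deg0 + 2 * m * (n - 2)"
    using assms by (simp_all add: complete_def)
  have "(\<Sum>v \<in> verts G. real (mdegree G v)) = real (\<Sum>v = 1..n. mdegree G v)"
    unfolding V by simp
  also have "\<dots> = real deg0 * 1 + 2 * real m * real (n - 2)"
    unfolding deg by simp
  also have "\<dots> \<le> real deg0 * real n + 2 * real m * real n"
    using assms by (intro add_mono mult_left_mono) auto
  also have "\<dots> = (real deg0 + 2 * real m) * real n" by (simp add: distrib_right)
  finally show ?thesis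
    using assms by (simp add: avg_degree_def V divide_le_eq)
qed

end

theorem mainTheorem9:
  fixes M :: pa_model and m :: nat and \<delta> :: real and G\<^sub>0 :: "nat mgraph"
    and \<Omega> :: "'w measure" and G :: "nat \<Rightarrow> 'w \<Rightarrow> nat mgraph"
  assumes "m \<ge> 2" and "\<delta> > - real m"
    and "multigraph G\<^sub>0" and "verts G\<^sub>0 = {1, 2}"
    and "real (mdegree G\<^sub>0 1) + \<delta> > 0" and "real (mdegree G\<^sub>0 2) + \<delta> > 0"
    and "mdegree G\<^sub>0 2 \<le> m"
    and "pa_sequence M m \<delta> G\<^sub>0 \<Omega> G"
  shows "\<exists>d::real. \<forall>\<epsilon>::real > 0. \<exists>\<alpha>::real > 0.
      (\<lambda>n. \<P>(\<omega> in \<Omega>. large_set_expander \<alpha> \<epsilon> d (G n \<omega>))) \<longlonglongrightarrow> 1 \<and>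
      (\<exists>c::real > 0. (\<lambda>n. \<P>(\<omega> in \<Omega>. expansion (G n \<omega>) \<epsilon> < ereal \<alpha>)) \<in> o(\<lambda>n. exp (- c * real n)))"
proof -
  interpret pa_params M m \<delta> G\<^sub>0 using assms(1-6) by (simp add: pa_params_def)
  \<comment> \<open>The degree bound is deterministic, so \<open>d\<close> can be fixed before
    \<open>\<epsilon>\<close>; only the expansion is random.\<close>
  let ?d = "real deg0 + 2 * real m"
  have prob: "\<P>(\<omega> in \<Omega>. P (G n \<omega>)) = measure_pmf.prob (pa_law (n - 2)) {g. P g}" if "n \<ge> 2" for n P
  proof -
    obtain k where "n = 2 + k" using le_Suc_ex \<open>n \<ge> 2\<close> by blast
    then have k: "n = Suc (Suc k)" by simp
    have "G n \<in> measurable \<Omega> (count_space UNIV)" using assms(8) that by (simp add: pa_sequence_def)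
    then have "measure (distr \<Omega> (count_space UNIV) (G n)) {g. P g} = \<P>(\<omega> in \<Omega>. P (G n \<omega>))"
      by (simp add: measure_distr vimage_def Int_def conj_commute)
    then show ?thesis unfolding k distr_pa_sequence[OF assms(8)] by simp
  qed
  have "\<exists>\<alpha>>0. (\<lambda>n. \<P>(\<omega> in \<Omega>. large_set_expander \<alpha> \<epsilon> ?d (G n \<omega>))) \<longlonglongrightarrow> 1 \<and>
      (\<exists>c>0. (\<lambda>n. \<P>(\<omega> in \<Omega>. expansion (G n \<omega>) \<epsilon> < ereal \<alpha>)) \<in> o(\<lambda>n. exp (- c * real n)))"
    if \<epsilon>: "\<epsilon> > 0" for \<epsilon> :: real
  proof -
    obtain \<alpha> \<kappa> where \<alpha>: "\<alpha> > 0" and \<kappa>: "\<kappa> > 0" and bound: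
      "\<forall>\<^sub>F n in sequentially. measure_pmf.prob (pa_law (n - 2)) {G. expansion G \<epsilon> < ereal \<alpha>}
        \<le> 9 * real n ^ Suc m * exp (- (\<kappa> * real n))"
      using prob_small_expansion[OF assms(1) \<epsilon>] by blast
    let ?bad = "\<lambda>n. \<P>(\<omega> in \<Omega>. expansion (G n \<omega>) \<epsilon> < ereal \<alpha>)"
    let ?f = "\<lambda>n. 9 * real n ^ Suc m * exp (- (\<kappa> * real n))"
    have le: "\<forall>\<^sub>F n in sequentially. ?bad n \<le> ?f n"
      using bound eventually_ge_at_top[of 2]
    proof eventually_elim
      case (elim n)
      then show ?case using prob[of n "\<lambda>g. expansion g \<epsilon> < ereal \<alpha>"] by simp
    qed
    have "?f \<in> o(\<lambda>n. exp (- (\<kappa> / 2) * real n))" by (rule power_exp_smallo[OF \<kappa>])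
    moreover have "?bad \<in> O(?f)"
      using le by (intro landau_o.big_mono) (auto elim!: eventually_mono)
    ultimately have o: "?bad \<in> o(\<lambda>n. exp (- (\<kappa> / 2) * real n))"
      by (rule landau_o.big_small_trans[rotated])
    have "?f \<longlonglongrightarrow> 0" using \<kappa> by real_asymp
    then have "(\<lambda>n. 1 - ?f n) \<longlonglongrightarrow> 1 - 0" by (intro tendsto_diff tendsto_const)
    then have "(\<lambda>n. 1 - ?f n) \<longlonglongrightarrow> 1" by simp
    moreover have "\<forall>\<^sub>F n in sequentially. 1 - ?f n \<le> \<P>(\<omega> in \<Omega>. large_set_expander \<alpha> \<epsilon> ?d (G n \<omega>))"
      using bound eventually_ge_at_top[of 2]
    proof eventually_elim
      case (elim n)
      let ?p = "pa_law (n - 2)"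
      have "1 - ?f n \<le> 1 - measure_pmf.prob ?p {G. expansion G \<epsilon> < ereal \<alpha>}" using elim by simp
      also have "\<dots> = measure_pmf.prob ?p (- {G. expansion G \<epsilon> < ereal \<alpha>})"
        using measure_pmf.prob_compl[of "{G. expansion G \<epsilon> < ereal \<alpha>}" ?p] by (simp add: Compl_eq_Diff_UNIV)
      also have "\<dots> \<le> measure_pmf.prob ?p {G. large_set_expander \<alpha> \<epsilon> ?d G}"
      proof (rule measure_pmf.finite_measure_mono_AE)
        have "large_set_expander \<alpha> \<epsilon> ?d H" if "H \<in> set_pmf ?p" "\<not> expansion H \<epsilon> < ereal \<alpha>" for H
        proof -
          have "Suc (Suc (n - 2)) = n" using elim by simp
          then have "complete n H" using pa_law_complete that by metis
          then show ?thesis using avg_degree_le that elim by (simp add: large_set_expander_def not_less)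
        qed
        then show "AE H in ?p. H \<in> - {G. expansion G \<epsilon> < ereal \<alpha>} \<longrightarrow> H \<in> {G. large_set_expander \<alpha> \<epsilon> ?d G}"
          by (simp add: AE_measure_pmf_iff)
      qed simp
      also have "\<dots> = \<P>(\<omega> in \<Omega>. large_set_expander \<alpha> \<epsilon> ?d (G n \<omega>))"
        by (rule prob[symmetric]) fact
      finally show ?case .
    qed
    moreover have "prob_space \<Omega>" using assms(8) by (simp add: pa_sequence_def)
    then have "\<forall>\<^sub>F n in sequentially. \<P>(\<omega> in \<Omega>. large_set_expander \<alpha> \<epsilon> ?d (G n \<omega>)) \<le> 1"
      by (simp add: prob_space.prob_le_1)
    ultimately have "(\<lambda>n. \<P>(\<omega> in \<Omega>. large_set_expander \<alpha> \<epsilon> ?d (G n \<omega>))) \<longlonglongrightarrow> 1"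
      by (rule tendsto_sandwich[OF _ _ _ tendsto_const, rotated 2])
    then show ?thesis using \<alpha> o \<kappa> by (intro exI[of _ \<alpha>] conjI exI[of _ "\<kappa> / 2"]) auto
  qed
  then show ?thesis by blast
qed

end
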